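(* Consider the linearized swing dynamics $\bm M\dot{\bm\omega}+\bm D\bm\omega=\delta\bm P(t)-\mathbb{L}\,\delta\bm\theta$, $\bm\omega=\delta\dot{\bm\theta}$, $t\ge0$, with $\delta\bm\theta(0)=\bm\omega(0)=0$ and constant damping-to-inertia ratio $d_i/m_i=\gamma>0$ for all $i$. Let the disturbance $\delta\bm P(t)$ be a noise acting on a set $N_n\subseteq\{1,\dots,n\}$ of network nodes (so $\delta P_i\equiv0$ for $i\notin N_n$), Gaussian, with $\overline{\delta P_i(t)}=0$ and $$\overline{\delta P_i(t)\,\delta P_j(t')}=\delta_{ij}\,\delta P_{0i}^2\,\exp\!\big[-|t-t'|/\tau_0\big],\qquad i,j\in N_n .$$ Let $\overline{\mathcal{P}^\infty}=\lim_{T\to\infty}\overline{\mathcal{P}(T)}$ be the noise-averaged primary control effort. In the limit of short noise correlation time, $\tau_0\ll\gamma^{-1},(\lambda_\alpha^D)^{-1}$ for all $\alpha\ge2$, one has to leading order in $\tau_0$ $$\overline{\mathcal{P}^\infty}=\tau_0\sum_{i\in N_n}\delta P_{0i}^2\left(\frac1{m_i}-\frac1{\sum_{j=1}^n m_j}\right),$$ i.e., with all other parameters fixed, the difference of the two sides is $o(\tau_0)$ as $\tau_0\to0^+$.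
   Context: Setting: a power network with nodes $i=1,\dots,n$, symmetric line susceptances $b_{ij}=b_{ji}\ge0$, inertia $m_i>0$, damping $d_i>0$, $\bm M=\mathrm{diag}\{m_i\}$, $\bm D=\mathrm{diag}\{d_i\}$. $\bm\theta^{(0)}$ is a stable synchronous stationary solution of $m_i\dot\omega_i+d_i\omega_i=P_i-\sum_j b_{ij}\sin(\theta_i-\theta_j)$, $\omega_i=\dot\theta_i$. The weighted Laplacian $\mathbb{L}$ has entries $\mathbb{L}_{ij}=-b_{ij}\cos(\theta_i^{(0)}-\theta_j^{(0)})$ for $i\neq j$ and $\mathbb{L}_{ii}=\sum_k b_{ik}\cos(\theta_i^{(0)}-\theta_k^{(0)})$ (sum over $k\neq i$). Since the synchronous state is stable, $\mathbb{L}$ is assumed symmetric positive semidefinite with a simple zero eigenvalue, with eigenvector $(1,\dots,1)/\sqrt n$. Set $\mathbb{L}^D=\bm D^{-1/2}\mathbb{L}\bm D^{-1/2}$, with orthonormal real eigenvectors $\bm u_1^D,\dots,\bm u_n^D$ and eigenvalues $\lambda_1^D=0$, $\lambda_\alpha^D>0$ for $\alpha\ge2$. The performance metric (primary control effort) is $$\mathcal{P}(T)=T^{-1}\int_0^T(\bm\omega^\top-\overline{\bm\omega}^\top)\,\bm D\,(\bm\omega-\overline{\bm\omega})\,\mathrm{d}t,$$ where $\overline{\bm\omega}^\top=(\dot\Delta,\dots,\dot\Delta)$ with $\dot\Delta(t)=\sum_i d_i\omega_i(t)/\sum_i d_i$ (here the bar on $\bm\omega$ denotes this network average). An overline on any other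 quantity denotes the statistical average (expectation) over the noise ensemble. *)

theory Defs
  imports "HOL-Probability.Probability" "HOL-Library.Landau_Symbols"
begin

text \<open>
  The network nodes are the elements of a finite type \<open>'n\<close>. Node quantities (angles, frequencies,
  inertias, dampings, powers) are vectors in \<open>real ^ 'n\<close>; \<open>b\<close> is the matrix of line susceptances.
\<close>

definition diag_matrix :: "real ^ 'n \<Rightarrow> real ^ 'n ^ 'n"
  where "diag_matrix v = (\<chi> i j. if i = j then v $ i else 0)"

definition positive_semidefinite :: "real ^ 'n ^ 'n \<Rightarrow> bool"
  where "positive_semidefinite A \<longleftrightarrow> transpose A = A \<and> (\<forall>x. 0 \<le> x \<bullet> (A *v x))"

text \<open>
  Only used for symmetric matrices, for which geometric and algebraic multiplicity agree.
\<close>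

definition simple_eigenvalue :: "real ^ 'n ^ 'n \<Rightarrow> real \<Rightarrow> bool"
  where "simple_eigenvalue A l \<longleftrightarrow> dim {x. A *v x = l *\<^sub>R x} = 1"

definition swing_solution ::
    "real ^ 'n ^ 'n \<Rightarrow> real ^ 'n \<Rightarrow> real ^ 'n \<Rightarrow> real ^ 'n \<Rightarrow>
     (real \<Rightarrow> real ^ 'n) \<Rightarrow> (real \<Rightarrow> real ^ 'n) \<Rightarrow> bool"
  where "swing_solution b m d p \<theta> \<omega> \<longleftrightarrow>
    (\<forall>t\<ge>0. (\<theta> has_vector_derivative \<omega> t) (at t within {0..}) \<and>
      (\<exists>\<omega>'. (\<omega> has_vector_derivative \<omega>') (at t within {0..}) \<and>
        (\<forall>i. m $ i * \<omega>' $ i + d $ i * \<omega> t $ i =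
             p $ i - (\<Sum>j\<in>UNIV. b $ i $ j * sin (\<theta> t $ i - \<theta> t $ j)))))"

text \<open>
  All nodes rotate at one common constant frequency \<open>\<Omega>\<close>, with constant angle differences. In the
  frame rotating at the synchronous frequency, \<open>\<Omega> = 0\<close> and the angles are constant.
\<close>

definition synchronous_state ::
    "real ^ 'n ^ 'n \<Rightarrow> real ^ 'n \<Rightarrow> real ^ 'n \<Rightarrow> real ^ 'n \<Rightarrow> real ^ 'n \<Rightarrow> bool"
  where "synchronous_state b m d p \<theta>0 \<longleftrightarrow>
    (\<exists>\<Omega>. swing_solution b m d p (\<lambda>t. \<chi> i. \<theta>0 $ i + \<Omega> * t) (\<lambda>t. \<chi> i. \<Omega>))"

definition weighted_laplacian :: "real ^ 'n ^ 'n \<Rightarrow> real ^ 'n \<Rightarrow> real ^ 'n ^ 'n"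
  where "weighted_laplacian b \<theta>0 =
    (\<chi> i j. if i = j then (\<Sum>k\<in>UNIV - {i}. b $ i $ k * cos (\<theta>0 $ i - \<theta>0 $ k))
            else - b $ i $ j * cos (\<theta>0 $ i - \<theta>0 $ j))"

text \<open>
  Point masses count as (degenerate) Gaussian distributions.
\<close>

definition gaussian_rv :: "'a measure \<Rightarrow> ('a \<Rightarrow> real) \<Rightarrow> bool"
  where "gaussian_rv M X \<longleftrightarrow> X \<in> borel_measurable M \<and>
    (\<exists>\<mu>. (AE x in M. X x = \<mu>) \<or> (\<exists>\<sigma>>0. distributed M lborel X (normal_density \<mu> \<sigma>)))"

definition gaussian_process :: "'a measure \<Rightarrow> 'i set \<Rightarrow> ('i \<Rightarrow> 'a \<Rightarrow> real) \<Rightarrow> bool"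
  where "gaussian_process M I X \<longleftrightarrow>
    (\<forall>F c. finite F \<longrightarrow> F \<subseteq> I \<longrightarrow> gaussian_rv M (\<lambda>x. \<Sum>s\<in>F. c s * X s x))"

text \<open>
  Zero-mean Gaussian noise on the nodes \<open>N\<close>, uncorrelated between different nodes, with standard
  deviation \<open>P0 $ i\<close> at node \<open>i\<close> and correlation time \<open>\<tau>\<close>.
\<close>

definition correlated_noise ::
    "'a measure \<Rightarrow> 'n set \<Rightarrow> real ^ 'n \<Rightarrow> real \<Rightarrow> (real \<Rightarrow> 'a \<Rightarrow> real ^ 'n) \<Rightarrow> bool"
  where "correlated_noise M N P0 \<tau> \<delta>P \<longleftrightarrow>
    (AE x in M. \<forall>i. i \<notin> N \<longrightarrow> (\<forall>t\<ge>0. \<delta>P t x $ i = 0)) \<and>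
    gaussian_process M (N \<times> {0..}) (\<lambda>(i, t) x. \<delta>P t x $ i) \<and>
    (\<forall>i\<in>N. \<forall>t\<ge>0. (\<integral>x. \<delta>P t x $ i \<partial>M) = 0) \<and>
    (\<forall>i\<in>N. \<forall>j\<in>N. \<forall>t\<ge>0. \<forall>t'\<ge>0.
       (\<integral>x. \<delta>P t x $ i * \<delta>P t' x $ j \<partial>M) =
         (if i = j then (P0 $ i)\<^sup>2 * exp (- \<bar>t - t'\<bar> / \<tau>) else 0))"

definition measurable_process :: "'a measure \<Rightarrow> (real \<Rightarrow> 'a \<Rightarrow> real ^ 'n) \<Rightarrow> bool"
  where "measurable_process M X \<longleftrightarrow>
    (\<lambda>(t, x). X t x) \<in> borel_measurable (restrict_space borel {0..} \<Otimes>\<^sub>M M)"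

text \<open>
  The linearized dynamics is solved pathwise, almost surely. Joint measurability of the response
  ensures that its time integrals are random variables; otherwise the Bochner expectation of the
  control effort would be \<open>0\<close> by convention.
\<close>

definition linear_response ::
    "'a measure \<Rightarrow> real ^ 'n ^ 'n \<Rightarrow> real ^ 'n \<Rightarrow> real ^ 'n \<Rightarrow> (real \<Rightarrow> 'a \<Rightarrow> real ^ 'n) \<Rightarrow>
     (real \<Rightarrow> 'a \<Rightarrow> real ^ 'n) \<Rightarrow> (real \<Rightarrow> 'a \<Rightarrow> real ^ 'n) \<Rightarrow> bool"
  where "linear_response M L m d \<delta>P \<delta>\<theta> \<omega> \<longleftrightarrow>
    measurable_process M \<delta>\<theta> \<and> measurable_process M \<omega> \<and>
    (AE x in M. \<delta>\<theta> 0 x = 0 \<and> \<omega> 0 x = 0 \<and>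
      (\<forall>t\<ge>0. ((\<lambda>s. \<delta>\<theta> s x) has_vector_derivative \<omega> t x) (at t within {0..}) \<and>
        (\<exists>\<omega>'. ((\<lambda>s. \<omega> s x) has_vector_derivative \<omega>') (at t within {0..}) \<and>
          diag_matrix m *v \<omega>' + diag_matrix d *v \<omega> t x = \<delta>P t x - L *v \<delta>\<theta> t x)))"

definition average_frequency :: "real ^ 'n \<Rightarrow> real ^ 'n \<Rightarrow> real ^ 'n"
  where "average_frequency d w =
    (\<chi> i. (\<Sum>j\<in>UNIV. d $ j * w $ j) / (\<Sum>j\<in>UNIV. d $ j))"

definition primary_control_effort :: "real ^ 'n \<Rightarrow> (real \<Rightarrow> real ^ 'n) \<Rightarrow> real \<Rightarrow> real"
  where "primary_control_effort d \<omega> T =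
    (1 / T) * (LBINT t:{0..T}.
      (\<omega> t - average_frequency d (\<omega> t)) \<bullet>
        (diag_matrix d *v (\<omega> t - average_frequency d (\<omega> t))))"

definition mean_control_effort ::
    "'a measure \<Rightarrow> real ^ 'n \<Rightarrow> (real \<Rightarrow> 'a \<Rightarrow> real ^ 'n) \<Rightarrow> real \<Rightarrow> real"
  where "mean_control_effort M d \<omega> T = (\<integral>x. primary_control_effort d (\<lambda>t. \<omega> t x) T \<partial>M)"

end

theory Submission
  imports Defs
begin

text \<open>
  In mass-weighted coordinates for the deviation from the network average, the dynamics reads
  \<open>y' = z\<close>, \<open>z' = f - \<gamma> z - A y\<close> with \<open>A\<close> symmetric and positive definite, and the control effort is
  the time average of \<open>\<gamma> (z \<bullet> z)\<close>. A Lyapunov function bounds the second moments of \<open>y\<close> and \<open>z\<close>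
  uniformly in time, so in the long-time average the dissipation \<open>\<gamma> E(z \<bullet> z)\<close> balances the injected
  power \<open>E(f \<bullet> z)\<close>. For fixed \<open>T\<close> and a unit vector \<open>a\<close>, the correlation of \<open>f(T) \<bullet> a\<close> with \<open>y(t)\<close>
  solves the same equation with the deterministic forcing \<open>exp (- (T - t) / \<tau>) R a\<close>; up to an error
  of size \<open>exp (- T / \<tau>)\<close> it is the particular solution with amplitude \<open>C\<close>,
  \<open>(1 / \<tau>\<^sup>2 + \<gamma> / \<tau> + A) C = R a\<close>. Hence the injected power tends to the sum of \<open>(C \<bullet> a) / \<tau>\<close> over an
  orthonormal basis, and \<open>C / \<tau> = \<tau> R a + O(\<tau>\<^sup>2)\<close>, whose leading term is the trace of the noise
  covariance \<open>R\<close>.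
\<close>

subsection \<open>Exchanging expectation and time integral\<close>

text \<open>By Tonelli the norm integrates to at most \<open>B\<close> times the length of
  \<open>{0..T}\<close>, so a first-moment bound that is uniform in time is enough.\<close>

lemma integrable_on_strip:
  fixes k :: "real \<Rightarrow> 'a \<Rightarrow> 'e::euclidean_space"
  assumes "sigma_finite_measure M"
    and meas [measurable]: "(\<lambda>(t, x). k t x) \<in> borel_measurable (borel \<Otimes>\<^sub>M M)"
    and bound: "\<And>t. t \<in> {0..T} \<Longrightarrow> (\<integral>\<^sup>+x. ennreal (norm (k t x)) \<partial>M) \<le> ennreal B"
  shows "integrable (lborel \<Otimes>\<^sub>M M) (\<lambda>(t, x). indicator {0..T} t *\<^sub>R k t x)"
proof (rule integrableI_bounded)
  interpret M: sigma_finite_measure M by fact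
  interpret P: pair_sigma_finite lborel M ..
  have [measurable]: "(\<lambda>(t, x). k t x) \<in> borel_measurable (lborel \<Otimes>\<^sub>M M)"
    using meas by simp
  show "(\<lambda>(t, x). indicator {0..T} t *\<^sub>R k t x) \<in> borel_measurable (lborel \<Otimes>\<^sub>M M)"
    by measurable
  have "(\<integral>\<^sup>+p. ennreal (norm (case p of (t, x) \<Rightarrow> indicator {0..T} t *\<^sub>R k t x)) \<partial>(lborel \<Otimes>\<^sub>M M))
      = (\<integral>\<^sup>+t. (\<integral>\<^sup>+x. ennreal (norm (indicator {0..T} t *\<^sub>R k t x)) \<partial>M) \<partial>lborel)"
    by (subst M.nn_integral_fst[symmetric]) (auto simp: case_prod_unfold)
  also have "\<dots> \<le> (\<integral>\<^sup>+t. ennreal B * indicator {0..T} t \<partial>lborel)"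
    by (intro nn_integral_mono) (use bound in \<open>auto split: split_indicator\<close>)
  also have "\<dots> = ennreal B * emeasure lborel {0..T}"
    by (simp add: nn_integral_cmult)
  also have "\<dots> < \<infinity>"
    by (simp add: ennreal_mult_less_top emeasure_lborel_Icc_eq)
  finally show "(\<integral>\<^sup>+p. ennreal (norm (case p of (t, x) \<Rightarrow> indicator {0..T} t *\<^sub>R k t x))
      \<partial>(lborel \<Otimes>\<^sub>M M)) < \<infinity>" .
qed

text \<open>The pathwise integral is a Lebesgue integral, as in the control effort. The integral of
  the expectation is given as \<open>has_integral\<close>, the form used in the energy balance and
  in the correlation equations.\<close>

lemma expectation_strip_Fubini:
  fixes k :: "real \<Rightarrow> 'a \<Rightarrow> 'e::euclidean_space"
  assumes "sigma_finite_measure M"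
    and meas: "(\<lambda>(t, x). k t x) \<in> borel_measurable (borel \<Otimes>\<^sub>M M)"
    and bound: "\<And>t. t \<in> {0..T} \<Longrightarrow> (\<integral>\<^sup>+x. ennreal (norm (k t x)) \<partial>M) \<le> ennreal B"
  shows "AE x in M. set_integrable lborel {0..T} (\<lambda>t. k t x)"
    and "integrable M (\<lambda>x. LBINT t:{0..T}. k t x)"
    and "((\<lambda>t. \<integral>x. k t x \<partial>M) has_integral (\<integral>x. (LBINT t:{0..T}. k t x) \<partial>M)) {0..T}"
proof -
  interpret M: sigma_finite_measure M by fact
  interpret P: pair_sigma_finite lborel M ..
  have I: "integrable (lborel \<Otimes>\<^sub>M M) (\<lambda>(t, x). indicator {0..T} t *\<^sub>R k t x)"
    using assms by (rule integrable_on_strip)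
  show "AE x in M. set_integrable lborel {0..T} (\<lambda>t. k t x)"
    using P.AE_integrable_snd[OF I] by (simp add: set_integrable_def)
  show "integrable M (\<lambda>x. LBINT t:{0..T}. k t x)"
    using P.integrable_snd[OF I] by (simp add: set_lebesgue_integral_def)
  have "set_integrable lborel {0..T} (\<lambda>t. \<integral>x. k t x \<partial>M)"
    using P.integrable_fst[OF I] by (simp add: set_integrable_def)
  from set_borel_integral_eq_integral[OF this]
  have "((\<lambda>t. \<integral>x. k t x \<partial>M) has_integral (LBINT t:{0..T}. \<integral>x. k t x \<partial>M)) {0..T}"
    by (simp add: has_integral_integrable_integral)
  moreover have "(LBINT t:{0..T}. \<integral>x. k t x \<partial>M) = (\<integral>x. (LBINT t:{0..T}. k t x) \<partial>M)"
    using P.Fubini_integral[OF I] by (simp add: set_lebesgue_integral_def)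
  ultimately show "((\<lambda>t. \<integral>x. k t x \<partial>M) has_integral (\<integral>x. (LBINT t:{0..T}. k t x) \<partial>M)) {0..T}"
    by simp
qed

text \<open>An integrated form of differentiating under the expectation: the fundamental theorem of
  calculus for the gauge integral holds along each path without continuity of \<open>k\<close>, and
  Fubini moves the expectation inside. Instead of a dominating function for difference quotients, a
  bound on the first moments of \<open>k\<close> suffices.\<close>

lemma has_integral_expectation_derivative:
  fixes h k :: "real \<Rightarrow> 'a \<Rightarrow> 'e::euclidean_space"
  assumes "sigma_finite_measure M" and "0 \<le> T"
    and meas: "(\<lambda>(t, x). k t x) \<in> borel_measurable (borel \<Otimes>\<^sub>M M)"
    and bound: "\<And>t. t \<in> {0..T} \<Longrightarrow> (\<integral>\<^sup>+x. ennreal (norm (k t x)) \<partial>M) \<le> ennreal B"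
    and h [measurable]: "h T \<in> borel_measurable M"
    and deriv: "\<And>t x. x \<in> space M \<Longrightarrow> t \<in> {0..T} \<Longrightarrow>
      ((\<lambda>s. h s x) has_vector_derivative k t x) (at t within {0..T})"
    and init: "\<And>x. x \<in> space M \<Longrightarrow> h 0 x = 0"
  shows "((\<lambda>t. \<integral>x. k t x \<partial>M) has_integral (\<integral>x. h T x \<partial>M)) {0..T}"
proof -
  have F: "AE x in M. set_integrable lborel {0..T} (\<lambda>t. k t x)"
    "integrable M (\<lambda>x. LBINT t:{0..T}. k t x)"
    "((\<lambda>t. \<integral>x. k t x \<partial>M) has_integral (\<integral>x. (LBINT t:{0..T}. k t x) \<partial>M)) {0..T}"
    by (rule expectation_strip_Fubini[OF assms(1) meas, where B = B]; simp add: bound)+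
  have "AE x in M. (LBINT t:{0..T}. k t x) = h T x"
    using F(1) AE_space
  proof eventually_elim
    case (elim x)
    have "((\<lambda>t. k t x) has_integral (h T x - h 0 x)) {0..T}"
      using elim deriv \<open>0 \<le> T\<close> by (intro fundamental_theorem_of_calculus) auto
    then show ?case
      using set_borel_integral_eq_integral(2)[OF elim(1)] init elim by (simp add: integral_unique)
  qed
  then have "(\<integral>x. (LBINT t:{0..T}. k t x) \<partial>M) = (\<integral>x. h T x \<partial>M)"
    using F(2) by (intro integral_cong_AE) auto
  then show ?thesis
    using F(3) by simp
qed

text \<open>Working in \<open>ennreal\<close> makes the claim trivial on paths where
  \<open>k\<close> is not integrable, so that Tonelli can be applied afterwards before any
  integrability is known.\<close>

lemma ennreal_le_nn_integral_derivative:
  fixes h h' k :: "real \<Rightarrow> real"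
  assumes "0 \<le> T" and [measurable]: "k \<in> borel_measurable borel"
    and nonneg: "\<And>t. 0 \<le> k t"
    and deriv: "\<And>t. t \<in> {0..T} \<Longrightarrow> (h has_vector_derivative h' t) (at t within {0..T})"
    and le: "\<And>t. t \<in> {0..T} \<Longrightarrow> h' t \<le> k t"
    and init: "h 0 = 0"
  shows "ennreal (h T) \<le> (\<integral>\<^sup>+t\<in>{0..T}. ennreal (k t) \<partial>lborel)"
proof (cases "(\<integral>\<^sup>+t\<in>{0..T}. ennreal (k t) \<partial>lborel) = \<infinity>")
  case False
  then have fin: "(\<integral>\<^sup>+t. ennreal (indicator {0..T} t * k t) \<partial>lborel) < \<infinity>"
    by (simp add: nn_integral_set_ennreal less_top mult.commute)
  have int: "integrable lborel (\<lambda>t. indicator {0..T} t * k t)"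
    by (rule integrableI_nonneg) (use fin nonneg in auto)
  then have set: "set_integrable lborel {0..T} k"
    by (simp add: set_integrable_def)
  have "(h' has_integral (h T - h 0)) {0..T}"
    using assms by (intro fundamental_theorem_of_calculus) auto
  moreover have "(k has_integral (LBINT t:{0..T}. k t)) {0..T}"
    using set_borel_integral_eq_integral[OF set] by (simp add: has_integral_integrable_integral)
  ultimately have "h T - h 0 \<le> (LBINT t:{0..T}. k t)"
    using le by (rule has_integral_le)
  then have "ennreal (h T) \<le> ennreal (LBINT t:{0..T}. k t)"
    using init by (intro ennreal_leI) simp
  also have "\<dots> = (\<integral>\<^sup>+t. ennreal (indicator {0..T} t * k t) \<partial>lborel)"
    using nn_integral_eq_integral[OF int] nonneg
    by (simp add: set_lebesgue_integral_def)
  also have "\<dots> = (\<integral>\<^sup>+t\<in>{0..T}. ennreal (k t) \<partial>lborel)"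
    by (simp add: nn_integral_set_ennreal mult.commute)
  finally show ?thesis .
qed simp

subsection \<open>Deterministic damped systems\<close>

text \<open>The system meant is \<open>u' = v\<close>,
  \<open>v' = g - \<gamma> *\<^sub>R v - A u\<close>, with the forcing \<open>g\<close> supplied by
  each lemma; \<open>\<mu>\<close> bounds the spectrum of \<open>A\<close> from below.\<close>

locale damped_system =
  fixes A :: "'e::euclidean_space \<Rightarrow> 'e" and \<gamma> \<mu> :: real
  assumes linear_A: "linear A"
    and sym: "\<And>u v. A u \<bullet> v = u \<bullet> A v"
    and coercive: "\<And>u. \<mu> * (u \<bullet> u) \<le> u \<bullet> A u"
    and \<mu>_pos: "\<mu> > 0" and \<gamma>_pos: "\<gamma> > 0"
begin

lemma bounded_linear_A: "bounded_linear A"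
  using linear_A by (simp add: linear_conv_bounded_linear)

lemma A_nonneg: "0 \<le> u \<bullet> A u"
  using coercive[of u] \<mu>_pos by (meson inner_ge_zero less_imp_le mult_nonneg_nonneg order_trans)

lemma A_has_vector_derivative:
  "(u has_vector_derivative u') F \<Longrightarrow> ((\<lambda>t. A (u t)) has_vector_derivative A u') F"
  by (rule bounded_linear.has_vector_derivative[OF bounded_linear_A])

lemma inner_has_vector_derivative:
  fixes u v :: "real \<Rightarrow> 'e"
  assumes "(u has_vector_derivative u') (at t within S)" "(v has_vector_derivative v') (at t within S)"
  shows "((\<lambda>t. u t \<bullet> v t) has_vector_derivative (u t \<bullet> v' + u' \<bullet> v t)) (at t within S)"
  using bounded_bilinear.has_vector_derivative[OF bounded_bilinear_inner assms] .

text \<open>The restoring force is conservative: by symmetry of \<open>A\<close> its work cancels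
  the change of the potential energy, which leaves the input power minus the damping loss.\<close>

lemma energy_has_vector_derivative:
  assumes "(u has_vector_derivative v t) (at t within S)"
    and "(v has_vector_derivative g - \<gamma> *\<^sub>R v t - A (u t)) (at t within S)"
  shows "((\<lambda>t. (v t \<bullet> v t + u t \<bullet> A (u t)) / 2) has_vector_derivative
    (g \<bullet> v t - \<gamma> * (v t \<bullet> v t))) (at t within S)"
proof -
  note d = inner_has_vector_derivative[OF assms(2) assms(2)]
    inner_has_vector_derivative[OF assms(1) A_has_vector_derivative[OF assms(1)]]
  have "((\<lambda>t. (v t \<bullet> v t + u t \<bullet> A (u t)) / 2) has_vector_derivative
    (v t \<bullet> (g - \<gamma> *\<^sub>R v t - A (u t)) + (g - \<gamma> *\<^sub>R v t - A (u t)) \<bullet> v t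
      + (u t \<bullet> A (v t) + v t \<bullet> A (u t))) / 2) (at t within S)"
    by (intro has_vector_derivative_divide has_vector_derivative_add d)
  moreover have "(v t \<bullet> (g - \<gamma> *\<^sub>R v t - A (u t)) + (g - \<gamma> *\<^sub>R v t - A (u t)) \<bullet> v t
      + (u t \<bullet> A (v t) + v t \<bullet> A (u t))) / 2 = g \<bullet> v t - \<gamma> * (v t \<bullet> v t)"
    using sym[of "u t" "v t"]
    by (simp add: inner_diff_left inner_diff_right inner_add_right inner_commute field_simps)
  ultimately show ?thesis by simp
qed

text \<open>Young's inequality, from the square of \<open>(2 * c) *\<^sub>R u - v\<close>. The
  weight is free, so that each cross term can be absorbed by the quadratic form that has room for
  it.\<close>

lemma inner_le_weighted:
  fixes u v :: 'e
  assumes "c > 0"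
  shows "u \<bullet> v \<le> c * (u \<bullet> u) + (v \<bullet> v) / (4 * c)"
proof -
  have "0 \<le> ((2 * c) *\<^sub>R u - v) \<bullet> ((2 * c) *\<^sub>R u - v)" by simp
  also have "\<dots> = 4 * c * (c * (u \<bullet> u) - u \<bullet> v + (v \<bullet> v) / (4 * c))"
    using assms by (simp add: inner_diff_left inner_diff_right inner_commute field_simps)
  finally show ?thesis using assms by (simp add: zero_le_mult_iff)
qed

text \<open>
  The cross term \<open>\<epsilon> * (u \<bullet> v)\<close> makes the energy decay exponentially, so that the second moments
  stay bounded instead of growing linearly in time.
\<close>

lemma lyapunov:
  obtains \<epsilon> c K :: real where "c > 0" "K \<ge> 0"
    and "\<And>u v. (v \<bullet> v + \<mu> * (u \<bullet> u)) / 4 \<le> (v \<bullet> v + u \<bullet> A u) / 2 + \<epsilon> * (u \<bullet> v)"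
    and "\<And>u v g. (g \<bullet> v - \<gamma> * (v \<bullet> v)) + \<epsilon> * (v \<bullet> v + u \<bullet> (g - \<gamma> *\<^sub>R v - A u))
      + c * ((v \<bullet> v + u \<bullet> A u) / 2 + \<epsilon> * (u \<bullet> v)) \<le> K * (g \<bullet> g)"
proof -
  \<comment> \<open>The first entry keeps the kinetic terms produced by the cross term below a
    quarter of the damping. The second gives \<open>\<epsilon>\<^sup>2 \<le> \<mu> / 4\<close>, so
    that the cross term is at most half of the energy.\<close>
  define \<epsilon> where "\<epsilon> = min (\<gamma> / 4 / (1 + \<gamma>\<^sup>2 / \<mu>)) (sqrt \<mu> / 2)"
  have pos: "1 + \<gamma>\<^sup>2 / \<mu> \<ge> 1" using \<mu>_pos by simp
  then have "\<gamma> / 4 / (1 + \<gamma>\<^sup>2 / \<mu>) > 0"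
    using \<gamma>_pos by (intro divide_pos_pos) linarith+
  then have \<epsilon>: "\<epsilon> > 0" unfolding \<epsilon>_def using \<mu>_pos by simp
  have \<epsilon>1: "\<epsilon> * (1 + \<gamma>\<^sup>2 / \<mu>) \<le> \<gamma> / 4"
  proof -
    have "\<epsilon> \<le> \<gamma> / 4 / (1 + \<gamma>\<^sup>2 / \<mu>)" unfolding \<epsilon>_def by simp
    then show ?thesis using pos by (simp add: pos_le_divide_eq del: divide_divide_eq_left)
  qed
  have "\<epsilon> * 1 \<le> \<epsilon> * (1 + \<gamma>\<^sup>2 / \<mu>)" using \<epsilon> pos by (intro mult_left_mono) auto
  then have \<epsilon>2: "\<epsilon> \<le> \<gamma>" using \<epsilon>1 \<gamma>_pos by linarith
  have "\<epsilon> \<le> sqrt \<mu> / 2" unfolding \<epsilon>_def by (rule min.cobounded2)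
  then have "\<epsilon>\<^sup>2 \<le> (sqrt \<mu> / 2)\<^sup>2" using \<epsilon> by (intro power_mono) auto
  then have \<epsilon>3: "\<epsilon>\<^sup>2 \<le> \<mu> / 4" using \<mu>_pos by (simp add: power_divide)
  have cross: "\<bar>\<epsilon> * (u \<bullet> v)\<bar> \<le> (v \<bullet> v + u \<bullet> A u) / 4" for u v
  proof -
    have "\<bar>\<epsilon> * (u \<bullet> v)\<bar> \<le> (\<epsilon>\<^sup>2) * (u \<bullet> u) + (v \<bullet> v) / 4"
      using inner_le_weighted[of 1 "\<epsilon> *\<^sub>R u" v] inner_le_weighted[of 1 "\<epsilon> *\<^sub>R u" "- v"]
      by (simp add: abs_le_iff power2_eq_square mult.assoc)
    also have "(\<epsilon>\<^sup>2) * (u \<bullet> u) \<le> \<mu> / 4 * (u \<bullet> u)"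
      using \<epsilon>3 by (intro mult_right_mono) auto
    also have "\<dots> \<le> (u \<bullet> A u) / 4" using coercive[of u] by simp
    finally show ?thesis by simp
  qed
  show ?thesis
  \<comment> \<open>The functional is at most
    \<open>3 / 4 * (v \<bullet> v + u \<bullet> A u)\<close>, so the rate
    \<open>2 * \<epsilon> / 3\<close> costs at most \<open>\<epsilon> / 2\<close> times that sum.
    This is covered by what the estimates \<open>1\<close> to \<open>5\<close> leave over:
    \<open>\<gamma> / 2 * (v \<bullet> v)\<close> and
    \<open>\<epsilon> / 2 * (u \<bullet> A u)\<close>. The constant
    \<open>1 / \<gamma> + \<epsilon> / \<mu>\<close> collects the weights of
    \<open>g \<bullet> g\<close> in \<open>1\<close> and \<open>2\<close>.\<close>
  proof (rule that[of "2 * \<epsilon> / 3" "1 / \<gamma> + \<epsilon> / \<mu>" \<epsilon>])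
    show "2 * \<epsilon> / 3 > 0" "1 / \<gamma> + \<epsilon> / \<mu> \<ge> 0" using \<epsilon> \<mu>_pos \<gamma>_pos by auto
    show "(v \<bullet> v + \<mu> * (u \<bullet> u)) / 4 \<le> (v \<bullet> v + u \<bullet> A u) / 2 + \<epsilon> * (u \<bullet> v)" for u v
      using cross[of u v] coercive[of u] by (simp add: abs_le_iff field_simps)
    fix u v g :: 'e
    have 1: "g \<bullet> v \<le> \<gamma> / 4 * (v \<bullet> v) + (g \<bullet> g) / \<gamma>"
      using inner_le_weighted[of "\<gamma> / 4" v g] \<gamma>_pos by (simp add: inner_commute)
    have 2: "\<epsilon> * (u \<bullet> g) \<le> \<epsilon> * (\<mu> / 4 * (u \<bullet> u) + (g \<bullet> g) / \<mu>)"
      using inner_le_weighted[of "\<mu> / 4" u g] \<mu>_pos \<epsilon> by (intro mult_left_mono) auto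
    have 3: "\<epsilon> * (u \<bullet> (- \<gamma> *\<^sub>R v)) \<le> \<epsilon> * (\<mu> / 4 * (u \<bullet> u) + \<gamma>\<^sup>2 * (v \<bullet> v) / \<mu>)"
      using inner_le_weighted[of "\<mu> / 4" u "- \<gamma> *\<^sub>R v"] \<mu>_pos \<epsilon>
      by (intro mult_left_mono) (auto simp: power2_eq_square mult.assoc)
    have 4: "\<epsilon> * (\<mu> * (u \<bullet> u)) \<le> \<epsilon> * (u \<bullet> A u)"
      using coercive[of u] \<epsilon> by (intro mult_left_mono) auto
    have 5: "(\<epsilon> * (1 + \<gamma>\<^sup>2 / \<mu>)) * (v \<bullet> v) \<le> \<gamma> / 4 * (v \<bullet> v)"
      using \<epsilon>1 by (intro mult_right_mono) auto
    have 6: "\<epsilon> * (v \<bullet> v) \<le> \<gamma> * (v \<bullet> v)"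
      using \<epsilon>2 by (intro mult_right_mono) auto
    have 7: "2 * \<epsilon> / 3 * (\<epsilon> * (u \<bullet> v)) \<le> 2 * \<epsilon> / 3 * ((v \<bullet> v + u \<bullet> A u) / 4)"
      using cross[of u v] \<epsilon> by (intro mult_left_mono) (auto simp: abs_le_iff)
    show "(g \<bullet> v - \<gamma> * (v \<bullet> v)) + \<epsilon> * (v \<bullet> v + u \<bullet> (g - \<gamma> *\<^sub>R v - A u))
      + 2 * \<epsilon> / 3 * ((v \<bullet> v + u \<bullet> A u) / 2 + \<epsilon> * (u \<bullet> v)) \<le> (1 / \<gamma> + \<epsilon> / \<mu>) * (g \<bullet> g)"
      using 1 2 3 4 5 6 7 by (simp add: inner_diff_right algebra_simps add_divide_distrib)
  qed
qed

section \<open>The shifted stiffness operator and the response to exponential forcing\<close>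

lemma resolvent_norm_le:
  assumes "s > 0" "s *\<^sub>R C + A C = r"
  shows "norm C \<le> norm r / s"
proof -
  \<comment> \<open>The equation is tested with \<open>C\<close> itself, and the nonnegative term
    \<open>C \<bullet> A C\<close> is dropped.\<close>
  have "s * (norm C)\<^sup>2 \<le> C \<bullet> (s *\<^sub>R C + A C)"
    using A_nonneg[of C] by (simp add: inner_add_right power2_norm_eq_inner)
  also have "\<dots> \<le> norm C * norm r"
    using assms(2) norm_cauchy_schwarz by metis
  finally have "norm C * (s * norm C) \<le> norm C * norm r"
    by (simp add: power2_eq_square mult_ac)
  then have "s * norm C \<le> norm r"
    by (cases "C = 0") auto
  then show ?thesis using assms(1) by (simp add: field_simps)
qed

text \<open>With \<open>r = 0\<close> the bound \<open>resolvent_norm_le\<close> shows that the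
  kernel is trivial, and an injective linear map of a finite-dimensional space into itself is
  onto.\<close>

lemma resolvent_exists:
  assumes "s > 0"
  shows "\<exists>C. s *\<^sub>R C + A C = r"
proof -
  have lin: "linear (\<lambda>C. s *\<^sub>R C + A C)"
    using linear_A by (intro linear_compose_add linear_scale_self) auto
  moreover have "inj (\<lambda>C. s *\<^sub>R C + A C)"
    unfolding linear_injective_0[OF lin] using resolvent_norm_le[OF assms] by fastforce
  ultimately have "surj (\<lambda>C. s *\<^sub>R C + A C)"
    by (rule linear_inj_imp_surj)
  then show ?thesis unfolding surj_def by (metis (no_types))
qed

lemma free_response_bound:
  assumes "0 \<le> T"
    and "\<And>t. t \<in> {0..T} \<Longrightarrow> (u has_vector_derivative v t) (at t within {0..T})"
    and "\<And>t. t \<in> {0..T} \<Longrightarrow> (v has_vector_derivative - \<gamma> *\<^sub>R v t - A (u t)) (at t within {0..T})"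
  shows "(norm (v T))\<^sup>2 \<le> v 0 \<bullet> v 0 + u 0 \<bullet> A (u 0)"
proof -
  let ?e = "\<lambda>t. (v t \<bullet> v t + u t \<bullet> A (u t)) / 2"
  have "((\<lambda>t. 0 \<bullet> v t - \<gamma> * (v t \<bullet> v t)) has_integral (?e T - ?e 0)) {0..T}"
    using assms by (intro fundamental_theorem_of_calculus energy_has_vector_derivative) auto
  then have "?e T - ?e 0 \<le> 0"
    by (rule has_integral_le[OF _ has_integral_0]) (use \<gamma>_pos in simp)
  then show ?thesis using A_nonneg[of "u T"] by (simp add: power2_norm_eq_inner)
qed

text \<open>
  The particular solution \<open>exp (- (T - t) / \<tau>) *\<^sub>R C\<close> has initial data of size \<open>exp (- T / \<tau>)\<close>, and the
  difference to it is a free response, whose energy does not increase.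
\<close>

lemma forced_response_bound:
  assumes "0 \<le> T" "\<tau> > 0"
    and u: "\<And>t. t \<in> {0..T} \<Longrightarrow> (u has_vector_derivative v t) (at t within {0..T})"
    and v: "\<And>t. t \<in> {0..T} \<Longrightarrow> (v has_vector_derivative
      exp (- (T - t) / \<tau>) *\<^sub>R r - \<gamma> *\<^sub>R v t - A (u t)) (at t within {0..T})"
    and init: "u 0 = 0" "v 0 = 0"
    and C: "(1 / \<tau>\<^sup>2 + \<gamma> / \<tau>) *\<^sub>R C + A C = r"
  shows "norm (v T - (1 / \<tau>) *\<^sub>R C) \<le> exp (- T / \<tau>) * sqrt (C \<bullet> C / \<tau>\<^sup>2 + C \<bullet> A C)"
proof -
  define E where "E t = exp (- (T - t) / \<tau>)" for t
  have dE: "(E has_real_derivative E t / \<tau>) (at t within {0..T})" for t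
    unfolding E_def using assms(2) by (auto intro!: derivative_eq_intros)
  have dE1: "((\<lambda>t. E t *\<^sub>R C) has_vector_derivative (E t / \<tau>) *\<^sub>R C) (at t within {0..T})" for t
    using dE[of t] by (auto intro!: derivative_eq_intros simp: has_real_derivative_iff_has_vector_derivative)
  have dE2: "((\<lambda>t. (E t / \<tau>) *\<^sub>R C) has_vector_derivative (E t / \<tau>\<^sup>2) *\<^sub>R C) (at t within {0..T})" for t
  proof -
    have "((\<lambda>t. E t / \<tau>) has_real_derivative E t / \<tau> / \<tau>) (at t within {0..T})"
      by (intro DERIV_cdivide dE)
    then have "((\<lambda>t. E t / \<tau>) has_vector_derivative E t / \<tau>\<^sup>2) (at t within {0..T})"
      by (simp add: has_real_derivative_iff_has_vector_derivative power2_eq_square)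
    from bounded_linear.has_vector_derivative[OF bounded_linear_scaleR_left this]
    show ?thesis .
  qed
  let ?u = "\<lambda>t. u t - E t *\<^sub>R C" and ?v = "\<lambda>t. v t - (E t / \<tau>) *\<^sub>R C"
  have A_diff: "A (u t - E t *\<^sub>R C) = A (u t) - E t *\<^sub>R A C" for t
    using linear_A by (simp add: linear_diff linear_scale)
  have "(norm (?v T))\<^sup>2 \<le> ?v 0 \<bullet> ?v 0 + ?u 0 \<bullet> A (?u 0)"
  proof (rule free_response_bound[OF assms(1)])
    fix t assume t: "t \<in> {0..T}"
    show "(?u has_vector_derivative ?v t) (at t within {0..T})"
      by (intro has_vector_derivative_diff u t dE1)
    have "(?v has_vector_derivative
      (E t *\<^sub>R r - \<gamma> *\<^sub>R v t - A (u t)) - (E t / \<tau>\<^sup>2) *\<^sub>R C) (at t within {0..T})"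
      by (intro has_vector_derivative_diff dE2 v[OF t, folded E_def])
    \<comment> \<open>Inertia contributes \<open>1 / \<tau>\<^sup>2\<close> and damping
      \<open>\<gamma> / \<tau>\<close> to the factor of \<open>C\<close>, so the equation
      \<open>C\<close> cancels the forcing exactly.\<close>
    moreover have "(E t *\<^sub>R r - \<gamma> *\<^sub>R v t - A (u t)) - (E t / \<tau>\<^sup>2) *\<^sub>R C = - \<gamma> *\<^sub>R ?v t - A (?u t)"
      unfolding A_diff C[symmetric] by (simp add: algebra_simps)
    ultimately show "(?v has_vector_derivative - \<gamma> *\<^sub>R ?v t - A (?u t)) (at t within {0..T})"
      by simp
  qed
  also have "?v 0 \<bullet> ?v 0 + ?u 0 \<bullet> A (?u 0) = (E 0)\<^sup>2 * (C \<bullet> C / \<tau>\<^sup>2 + C \<bullet> A C)"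
    unfolding A_diff using init linear_A
    by (simp add: linear_0 power2_eq_square algebra_simps)
  finally have "norm (?v T) \<le> sqrt ((E 0)\<^sup>2 * (C \<bullet> C / \<tau>\<^sup>2 + C \<bullet> A C))"
    by (rule real_le_rsqrt)
  then show ?thesis
    by (simp add: E_def real_sqrt_mult)
qed

text \<open>Multiplied by \<open>\<tau>\<close>, the equation says that the difference is
  \<open>- (\<gamma> *\<^sub>R C + \<tau> *\<^sub>R A C)\<close>. Since the shift is at least
  \<open>1 / \<tau>\<^sup>2\<close>, the resolvent bound makes \<open>C\<close> itself of order
  \<open>\<tau>\<^sup>2\<close>. The constant \<open>K\<close> is uniform in \<open>\<tau>\<close>
  and \<open>C\<close>.\<close>

lemma resolvent_asymptotics:
  obtains K where "\<And>\<tau> C. \<lbrakk>\<tau> > 0; \<tau> \<le> 1; (1 / \<tau>\<^sup>2 + \<gamma> / \<tau>) *\<^sub>R C + A C = r\<rbrakk> \<Longrightarrow>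
    norm ((1 / \<tau>) *\<^sub>R C - \<tau> *\<^sub>R r) \<le> K * \<tau>\<^sup>2"
proof
  fix \<tau> :: real and C assume \<tau>: "\<tau> > 0" "\<tau> \<le> 1" and C: "(1 / \<tau>\<^sup>2 + \<gamma> / \<tau>) *\<^sub>R C + A C = r"
  let ?s = "1 / \<tau>\<^sup>2 + \<gamma> / \<tau>"
  have s: "1 / \<tau>\<^sup>2 \<le> ?s" "0 < 1 / \<tau>\<^sup>2" using \<tau> \<gamma>_pos by auto
  note spos = order.strict_trans2[OF s(2,1)]
  have "norm C \<le> norm r / ?s"
    using spos C by (rule resolvent_norm_le)
  also have "\<dots> \<le> norm r / (1 / \<tau>\<^sup>2)"
    using s spos by (intro divide_left_mono mult_pos_pos) simp_all
  finally have nC: "norm C \<le> norm r * \<tau>\<^sup>2" by simp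
  have "\<tau> *\<^sub>R r = (1 / \<tau>) *\<^sub>R C + \<gamma> *\<^sub>R C + \<tau> *\<^sub>R A C"
    unfolding C[symmetric] using \<tau> by (simp add: algebra_simps power2_eq_square)
  then have "(1 / \<tau>) *\<^sub>R C - \<tau> *\<^sub>R r = - (\<gamma> *\<^sub>R C + \<tau> *\<^sub>R A C)"
    by simp
  then have "norm ((1 / \<tau>) *\<^sub>R C - \<tau> *\<^sub>R r) = norm (\<gamma> *\<^sub>R C + \<tau> *\<^sub>R A C)"
    by (simp only: norm_minus_cancel)
  also have "\<dots> \<le> \<gamma> * norm C + \<tau> * norm (A C)"
    using norm_triangle_ineq[of "\<gamma> *\<^sub>R C" "\<tau> *\<^sub>R A C"] \<tau> \<gamma>_pos by simp
  also have "\<tau> * norm (A C) \<le> 1 * (norm C * onorm A)"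
    using \<tau> onorm[OF bounded_linear_A, of C] by (intro mult_mono) (auto simp: mult.commute)
  also have "\<gamma> * norm C + 1 * (norm C * onorm A) = (\<gamma> + onorm A) * norm C"
    by (simp add: algebra_simps)
  also have "\<dots> \<le> (\<gamma> + onorm A) * (norm r * \<tau>\<^sup>2)"
    using nC \<gamma>_pos onorm_pos_le[OF bounded_linear_A] by (intro mult_left_mono) auto
  finally show "norm ((1 / \<tau>) *\<^sub>R C - \<tau> *\<^sub>R r) \<le> (\<gamma> + onorm A) * norm r * \<tau>\<^sup>2"
    by (simp add: mult.assoc)
qed

end

subsection \<open>Systems driven by exponentially correlated noise\<close>

lemma borel_measurable_section:
  assumes "(\<lambda>(t, x). k t x) \<in> borel_measurable (N \<Otimes>\<^sub>M M)" and "t \<in> space N"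
  shows "k t \<in> borel_measurable M"
  using measurable_compose[OF measurable_Pair1'[OF assms(2)] assms(1)] by simp

lemma continuous_on_indefinite_has_integral:
  fixes g G :: "real \<Rightarrow> 'e::euclidean_space"
  assumes "\<And>t. t \<in> {0..T} \<Longrightarrow> (g has_integral G t) {0..t}"
  shows "continuous_on {0..T} G"
proof (cases "0 \<le> T")
  case True
  then have "g integrable_on {0..T}"
    using assms[of T] by auto
  from indefinite_integral_continuous_1[OF this] show ?thesis
    by (rule continuous_on_eq) (use assms in \<open>simp add: integral_unique\<close>)
qed auto

lemma indefinite_has_integral_has_vector_derivative:
  fixes g G :: "real \<Rightarrow> 'e::euclidean_space"
  assumes "\<And>t. t \<in> {0..T} \<Longrightarrow> (g has_integral G t) {0..t}"
    and "continuous_on {0..T} g" and t: "t \<in> {0..T}"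
  shows "(G has_vector_derivative g t) (at t within {0..T})"
proof (rule has_vector_derivative_transform[OF t])
  show "((\<lambda>t. integral {0..t} g) has_vector_derivative g t) (at t within {0..T})"
    using assms by (intro integral_has_vector_derivative)
  show "G s = integral {0..s} g" if "s \<in> {0..T}" for s
    using assms(1)[OF that] by (simp add: integral_unique)
qed

text \<open>The noise enters through its second moments, with \<open>R\<close> its equal-time
  covariance operator. The pathwise equations hold for every \<open>x\<close> of the space;
  exceptional null sets are removed before the locale is instantiated.\<close>

locale noise_driven_system = damped_system A \<gamma> \<mu> + prob_space M
  for A :: "'e::euclidean_space \<Rightarrow> 'e" and \<gamma> \<mu> :: real and M :: "'a measure" +
  fixes y z f :: "real \<Rightarrow> 'a \<Rightarrow> 'e" and R :: "'e \<Rightarrow> 'e" and \<tau> :: real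
  assumes \<tau>_pos: "\<tau> > 0"
    and meas_y [measurable]: "(\<lambda>(t, x). y t x) \<in> borel_measurable (borel \<Otimes>\<^sub>M M)"
    and meas_z [measurable]: "(\<lambda>(t, x). z t x) \<in> borel_measurable (borel \<Otimes>\<^sub>M M)"
    and meas_f [measurable]: "(\<lambda>(t, x). f t x) \<in> borel_measurable (borel \<Otimes>\<^sub>M M)"
    and y_deriv: "\<And>t x. x \<in> space M \<Longrightarrow> t \<ge> 0 \<Longrightarrow>
      ((\<lambda>s. y s x) has_vector_derivative z t x) (at t within {0..})"
    and z_deriv: "\<And>t x. x \<in> space M \<Longrightarrow> t \<ge> 0 \<Longrightarrow>
      ((\<lambda>s. z s x) has_vector_derivative f t x - \<gamma> *\<^sub>R z t x - A (y t x)) (at t within {0..})"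
    and init: "\<And>x. x \<in> space M \<Longrightarrow> y 0 x = 0" "\<And>x. x \<in> space M \<Longrightarrow> z 0 x = 0"
    and f_square_integrable: "\<And>t. t \<ge> 0 \<Longrightarrow> integrable M (\<lambda>x. (norm (f t x))\<^sup>2)"
    and f_covariance: "\<And>s t a. s \<ge> 0 \<Longrightarrow> t \<ge> 0 \<Longrightarrow> a \<in> Basis \<Longrightarrow>
      (\<integral>x. (f s x \<bullet> a) *\<^sub>R f t x \<partial>M) = exp (- \<bar>s - t\<bar> / \<tau>) *\<^sub>R R a"
begin

section \<open>Second moments bounded uniformly in time\<close>

lemma meas_A [measurable]: "A \<in> borel_measurable borel"
  using bounded_linear_A by (intro borel_measurable_continuous_onI linear_continuous_on)

lemma meas_sections [measurable]:
  "y t \<in> borel_measurable M" "z t \<in> borel_measurable M" "f t \<in> borel_measurable M"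
  using borel_measurable_section[OF meas_y, of t] borel_measurable_section[OF meas_z, of t]
    borel_measurable_section[OF meas_f, of t] by simp_all

lemmas y_deriv_Icc = has_vector_derivative_within_subset[OF y_deriv, of _ _ "{0..T}" for T]
lemmas z_deriv_Icc = has_vector_derivative_within_subset[OF z_deriv, of _ _ "{0..T}" for T]

text \<open>The trace of the covariance operator; by stationarity it is the second moment of the
  noise at every time.\<close>

definition noise_power :: real
  where "noise_power = (\<Sum>a\<in>Basis. R a \<bullet> a)"

lemma f_second_moment:
  assumes "t \<ge> 0"
  shows "(\<integral>x. (norm (f t x))\<^sup>2 \<partial>M) = noise_power"
proof -
  have int: "integrable M (\<lambda>x. (f t x \<bullet> a) *\<^sub>R f t x)" if "a \<in> Basis" for a
  proof (rule Bochner_Integration.integrable_bound[OF f_square_integrable[OF assms]])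
    have "\<bar>f t x \<bullet> a\<bar> * norm (f t x) \<le> norm (f t x) * norm (f t x)" for x
      using that by (intro mult_right_mono Basis_le_norm) auto
    then show "AE x in M. norm ((f t x \<bullet> a) *\<^sub>R f t x) \<le> norm ((norm (f t x))\<^sup>2)"
      by (simp add: power2_eq_square)
  qed measurable
  have "(norm (f t x))\<^sup>2 = (\<Sum>a\<in>Basis. ((f t x \<bullet> a) *\<^sub>R f t x) \<bullet> a)" for x
    unfolding power2_norm_eq_inner by (subst euclidean_inner) simp
  then have "(\<integral>x. (norm (f t x))\<^sup>2 \<partial>M) = (\<Sum>a\<in>Basis. (\<integral>x. (f t x \<bullet> a) *\<^sub>R f t x \<partial>M) \<bullet> a)"
    using int by (simp add: Bochner_Integration.integral_sum del: inner_scaleR_left)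
  then show ?thesis
    using f_covariance[OF assms assms] by (simp add: noise_power_def)
qed

lemma f_second_moment_nn:
  assumes "t \<ge> 0"
  shows "(\<integral>\<^sup>+x. ennreal ((norm (f t x))\<^sup>2) \<partial>M) = ennreal noise_power"
  using nn_integral_eq_integral[OF f_square_integrable[OF assms]] f_second_moment[OF assms] by simp

lemma noise_power_nonneg: "noise_power \<ge> 0"
  using f_second_moment[of 0] by (metis Bochner_Integration.integral_nonneg order_refl zero_le_power2)

text \<open>One pathwise majorant for all quadratic expressions in \<open>f\<close>,
  \<open>z\<close> and \<open>y\<close>, so that a single moment bound makes all their products
  integrable.\<close>

definition energy_scale :: "real \<Rightarrow> 'a \<Rightarrow> real"
  where "energy_scale t x = (norm (f t x))\<^sup>2 + (norm (z t x))\<^sup>2 + (norm (y t x))\<^sup>2"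

lemma meas_energy_scale [measurable]: "energy_scale t \<in> borel_measurable M"
  unfolding energy_scale_def by measurable

text \<open>Along each path the Lyapunov function \<open>H\<close> has derivative at most
  \<open>K * (f \<bullet> f) - c * H\<close>. An integrating factor and Tonelli bound its
  expectation by \<open>K * noise_power\<close> times the integral of
  \<open>exp (c * (s - t))\<close> over \<open>{0..t}\<close>, which is at most \<open>1 / c\<close>
  for every \<open>t\<close>. Nonnegative integrals are used because integrability of the response
  is not yet known.\<close>

lemma bounded_second_moments:
  obtains B where "B \<ge> 0" and "\<And>t. t \<ge> 0 \<Longrightarrow> (\<integral>\<^sup>+x. ennreal (energy_scale t x) \<partial>M) \<le> ennreal B"
proof -
  interpret P: pair_sigma_finite lborel M ..
  have [measurable]: "(\<lambda>(t, x). f t x) \<in> borel_measurable (lborel \<Otimes>\<^sub>M M)"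
    using meas_f by simp
  obtain \<epsilon> c K where c: "c > 0" and K: "K \<ge> 0"
    and lower: "\<And>u v. (v \<bullet> v + \<mu> * (u \<bullet> u)) / 4 \<le> (v \<bullet> v + u \<bullet> A u) / 2 + \<epsilon> * (u \<bullet> v)"
    and rate: "\<And>u v g. (g \<bullet> v - \<gamma> * (v \<bullet> v)) + \<epsilon> * (v \<bullet> v + u \<bullet> (g - \<gamma> *\<^sub>R v - A u))
      + c * ((v \<bullet> v + u \<bullet> A u) / 2 + \<epsilon> * (u \<bullet> v)) \<le> K * (g \<bullet> g)"
    by (rule lyapunov, rule that, assumption+)
  define H where "H t x = (z t x \<bullet> z t x + y t x \<bullet> A (y t x)) / 2 + \<epsilon> * (y t x \<bullet> z t x)" for t x
  have H_nonneg: "0 \<le> H t x" for t x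
  proof -
    have "0 \<le> (z t x \<bullet> z t x + \<mu> * (y t x \<bullet> y t x)) / 4" using \<mu>_pos by simp
    then show ?thesis using lower[of "z t x" "y t x"] unfolding H_def by (rule order_trans)
  qed
  have [measurable]: "H t \<in> borel_measurable M" for t
    unfolding H_def by measurable
  have H_bound: "(\<integral>\<^sup>+x. ennreal (H t x) \<partial>M) \<le> ennreal (K * noise_power / c)" if "t \<ge> 0" for t
  proof -
    have "ennreal (H t x) \<le> (\<integral>\<^sup>+s\<in>{0..t}. ennreal (K * exp (c * (s - t)) * (norm (f s x))\<^sup>2) \<partial>lborel)"
      if x: "x \<in> space M" for x
    proof -
      have H_deriv: "((\<lambda>s. H s x) has_vector_derivative
        ((f s x \<bullet> z s x - \<gamma> * (z s x \<bullet> z s x)) +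
          \<epsilon> * (y s x \<bullet> (f s x - \<gamma> *\<^sub>R z s x - A (y s x)) + z s x \<bullet> z s x))) (at s within {0..t})"
        if "s \<in> {0..t}" for s
        unfolding H_def using x that
        by (intro has_vector_derivative_add energy_has_vector_derivative inner_has_vector_derivative
            has_vector_derivative_mult_right y_deriv_Icc z_deriv_Icc) auto
      have E_deriv: "((\<lambda>s. exp (c * (s - t))) has_vector_derivative c * exp (c * (s - t)))
        (at s within {0..t})" for s
        unfolding has_real_derivative_iff_has_vector_derivative[symmetric]
        by (auto intro!: derivative_eq_intros)
      let ?h' = "\<lambda>s. exp (c * (s - t)) * ((f s x \<bullet> z s x - \<gamma> * (z s x \<bullet> z s x)) +
            \<epsilon> * (y s x \<bullet> (f s x - \<gamma> *\<^sub>R z s x - A (y s x)) + z s x \<bullet> z s x))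
          + c * exp (c * (s - t)) * H s x"
      have "ennreal (exp (c * (t - t)) * H t x)
        \<le> (\<integral>\<^sup>+s\<in>{0..t}. ennreal (K * exp (c * (s - t)) * (norm (f s x))\<^sup>2) \<partial>lborel)"
      proof (rule ennreal_le_nn_integral_derivative[OF \<open>t \<ge> 0\<close>, where h' = ?h'
            and h = "\<lambda>s. exp (c * (s - t)) * H s x"])
        show "(\<lambda>s. K * exp (c * (s - t)) * (norm (f s x))\<^sup>2) \<in> borel_measurable borel"
          using x by measurable
        show "0 \<le> K * exp (c * (s - t)) * (norm (f s x))\<^sup>2" for s
          using K by simp
        show "exp (c * (0 - t)) * H 0 x = 0"
          using init x linear_A by (simp add: H_def linear_0)
        fix s assume s: "s \<in> {0..t}"
        show "((\<lambda>s. exp (c * (s - t)) * H s x) has_vector_derivative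
          (exp (c * (s - t)) * ((f s x \<bullet> z s x - \<gamma> * (z s x \<bullet> z s x)) +
            \<epsilon> * (y s x \<bullet> (f s x - \<gamma> *\<^sub>R z s x - A (y s x)) + z s x \<bullet> z s x))
          + c * exp (c * (s - t)) * H s x)) (at s within {0..t})"
          by (intro has_vector_derivative_mult E_deriv H_deriv s)
        have "exp (c * (s - t)) * ((f s x \<bullet> z s x - \<gamma> * (z s x \<bullet> z s x)) +
            \<epsilon> * (z s x \<bullet> z s x + y s x \<bullet> (f s x - \<gamma> *\<^sub>R z s x - A (y s x))) + c * H s x)
          \<le> exp (c * (s - t)) * (K * (f s x \<bullet> f s x))"
          using rate[of "f s x" "z s x" "y s x"] unfolding H_def by (intro mult_left_mono) auto
        then show "exp (c * (s - t)) * ((f s x \<bullet> z s x - \<gamma> * (z s x \<bullet> z s x)) +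
            \<epsilon> * (y s x \<bullet> (f s x - \<gamma> *\<^sub>R z s x - A (y s x)) + z s x \<bullet> z s x))
          + c * exp (c * (s - t)) * H s x \<le> K * exp (c * (s - t)) * (norm (f s x))\<^sup>2"
          by (simp add: power2_norm_eq_inner algebra_simps)
      qed
      then show ?thesis by simp
    qed
    then have "(\<integral>\<^sup>+x. ennreal (H t x) \<partial>M) \<le>
      (\<integral>\<^sup>+x. (\<integral>\<^sup>+s\<in>{0..t}. ennreal (K * exp (c * (s - t)) * (norm (f s x))\<^sup>2) \<partial>lborel) \<partial>M)"
      by (intro nn_integral_mono)
    also have "\<dots> = (\<integral>\<^sup>+s. (\<integral>\<^sup>+x. ennreal (K * exp (c * (s - t)) * (norm (f s x))\<^sup>2) *
        indicator {0..t} s \<partial>M) \<partial>lborel)"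
      by (rule P.Fubini') measurable
    also have "\<dots> = (\<integral>\<^sup>+s. ennreal (K * noise_power * exp (c * (s - t))) * indicator {0..t} s \<partial>lborel)"
    proof (rule nn_integral_cong)
      fix s :: real
      show "(\<integral>\<^sup>+x. ennreal (K * exp (c * (s - t)) * (norm (f s x))\<^sup>2) * indicator {0..t} s \<partial>M)
        = ennreal (K * noise_power * exp (c * (s - t))) * indicator {0..t} s"
      proof (cases "s \<in> {0..t}")
        case True
        have "(\<integral>\<^sup>+x. ennreal (K * exp (c * (s - t)) * (norm (f s x))\<^sup>2) \<partial>M)
          = (\<integral>\<^sup>+x. ennreal (K * exp (c * (s - t))) * ennreal ((norm (f s x))\<^sup>2) \<partial>M)"
          using K by (intro nn_integral_cong ennreal_mult) auto
        also have "\<dots> = ennreal (K * exp (c * (s - t))) * ennreal noise_power"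
          using True by (simp add: nn_integral_cmult f_second_moment_nn)
        also have "\<dots> = ennreal (K * exp (c * (s - t)) * noise_power)"
          using K noise_power_nonneg by (intro ennreal_mult[symmetric]) auto
        finally show ?thesis using True by (simp add: mult_ac)
      qed simp
    qed
    also have "\<dots> = ennreal (K * noise_power / c * exp (c * (t - t)) - K * noise_power / c * exp (c * (0 - t)))"
      using c K noise_power_nonneg \<open>t \<ge> 0\<close>
      by (intro nn_integral_FTC_Icc) (auto intro!: derivative_eq_intros)
    also have "\<dots> \<le> ennreal (K * noise_power / c)"
      using c K noise_power_nonneg by (intro ennreal_leI) simp
    finally show ?thesis .
  qed
  \<comment> \<open>By \<open>lower\<close>, the velocity part is at most \<open>4 * H\<close> and
    the position part at most \<open>4 / \<mu> * H\<close>.\<close>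
  let ?b = "4 + 4 / \<mu>"
  show ?thesis
  proof (rule that[of "noise_power + ?b * (K * noise_power / c)"])
    show "0 \<le> noise_power + ?b * (K * noise_power / c)"
      using noise_power_nonneg \<mu>_pos K c by simp
    fix t :: real assume t: "t \<ge> 0"
    have "energy_scale t x \<le> (norm (f t x))\<^sup>2 + ?b * H t x" for x
    proof -
      have "z t x \<bullet> z t x + \<mu> * (y t x \<bullet> y t x) \<le> 4 * H t x"
        using lower[of "z t x" "y t x"] unfolding H_def[symmetric] by simp
      moreover have "0 \<le> \<mu> * (y t x \<bullet> y t x)" "0 \<le> z t x \<bullet> z t x" using \<mu>_pos by auto
      ultimately have "z t x \<bullet> z t x \<le> 4 * H t x" "\<mu> * (y t x \<bullet> y t x) \<le> 4 * H t x"
        by linarith+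
      moreover from this(2) have "y t x \<bullet> y t x \<le> 4 / \<mu> * H t x"
        using \<mu>_pos by (simp add: field_simps)
      ultimately show ?thesis
        by (simp add: energy_scale_def power2_norm_eq_inner distrib_right)
    qed
    then have "(\<integral>\<^sup>+x. ennreal (energy_scale t x) \<partial>M) \<le>
      (\<integral>\<^sup>+x. ennreal ((norm (f t x))\<^sup>2) + ennreal ?b * ennreal (H t x) \<partial>M)"
      using H_nonneg \<mu>_pos by (intro nn_integral_mono) (simp flip: ennreal_mult ennreal_plus add: ennreal_leI)
    also have "\<dots> = ennreal noise_power + ennreal ?b * (\<integral>\<^sup>+x. ennreal (H t x) \<partial>M)"
      using f_second_moment_nn[OF t] by (simp add: nn_integral_add nn_integral_cmult)
    also have "\<dots> \<le> ennreal noise_power + ennreal ?b * ennreal (K * noise_power / c)"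
      by (intro add_left_mono mult_left_mono H_bound t) simp
    also have "\<dots> = ennreal (noise_power + ?b * (K * noise_power / c))"
      using noise_power_nonneg \<mu>_pos K c by (simp flip: ennreal_mult ennreal_plus)
    finally show "(\<integral>\<^sup>+x. ennreal (energy_scale t x) \<partial>M) \<le> ennreal (noise_power + ?b * (K * noise_power / c))" .
  qed
qed

text \<open>Fixes one of the bounds just obtained, so that later estimates in the locale can name
  it.\<close>

definition moment_bound :: real
  where "moment_bound = (SOME B. B \<ge> 0 \<and> (\<forall>t\<ge>0. (\<integral>\<^sup>+x. ennreal (energy_scale t x) \<partial>M) \<le> ennreal B))"

lemma moment_bound:
  shows moment_bound_nonneg: "moment_bound \<ge> 0"
    and "t \<ge> 0 \<Longrightarrow> (\<integral>\<^sup>+x. ennreal (energy_scale t x) \<partial>M) \<le> ennreal moment_bound"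
proof -
  have "\<exists>B\<ge>0. \<forall>t\<ge>0. (\<integral>\<^sup>+x. ennreal (energy_scale t x) \<partial>M) \<le> ennreal B"
    using bounded_second_moments by metis
  then have "moment_bound \<ge> 0 \<and> (\<forall>t\<ge>0. (\<integral>\<^sup>+x. ennreal (energy_scale t x) \<partial>M) \<le> ennreal moment_bound)"
    unfolding moment_bound_def by (rule someI_ex)
  then show "moment_bound \<ge> 0"
    and "t \<ge> 0 \<Longrightarrow> (\<integral>\<^sup>+x. ennreal (energy_scale t x) \<partial>M) \<le> ennreal moment_bound"
    by auto
qed

text \<open>Two times are allowed because the correlations below pair the noise at one time with the
  response at another.\<close>

lemma nn_integral_quadratic_bound:
  assumes c: "c \<ge> 0" and "s \<ge> 0" "t \<ge> 0"
    and k: "\<And>x. k x \<le> c * (energy_scale s x + energy_scale t x)"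
  shows "(\<integral>\<^sup>+x. ennreal (k x) \<partial>M) \<le> ennreal (c * (2 * moment_bound))"
proof -
  have nonneg: "0 \<le> energy_scale r x" for r x by (simp add: energy_scale_def)
  have "(\<integral>\<^sup>+x. ennreal (k x) \<partial>M) \<le>
    (\<integral>\<^sup>+x. ennreal c * (ennreal (energy_scale s x) + ennreal (energy_scale t x)) \<partial>M)"
    using k c nonneg
    by (intro nn_integral_mono) (simp flip: ennreal_mult ennreal_plus add: ennreal_leI)
  also have "\<dots> = ennreal c * ((\<integral>\<^sup>+x. ennreal (energy_scale s x) \<partial>M)
      + (\<integral>\<^sup>+x. ennreal (energy_scale t x) \<partial>M))"
    by (simp add: nn_integral_add nn_integral_cmult)
  also have "\<dots> \<le> ennreal c * (ennreal moment_bound + ennreal moment_bound)"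
    using assms by (intro mult_left_mono add_mono moment_bound) auto
  also have "\<dots> = ennreal (c * (2 * moment_bound))"
    using moment_bound_nonneg c by (simp flip: ennreal_mult ennreal_plus)
  finally show ?thesis .
qed

lemma integrable_quadratic:
  fixes k :: "'a \<Rightarrow> 'b::{banach, second_countable_topology}"
  assumes "k \<in> borel_measurable M" "c \<ge> 0" "s \<ge> 0" "t \<ge> 0"
    and "\<And>x. norm (k x) \<le> c * (energy_scale s x + energy_scale t x)"
  shows "integrable M k"
  using assms(1) nn_integral_quadratic_bound[OF assms(2-5)]
  by (intro integrableI_bounded) (auto intro: le_less_trans)

section \<open>Correlations between the noise and the response\<close>

lemma norm_le_energy_scale:
  "(norm (f t x))\<^sup>2 \<le> energy_scale t x" "(norm (z t x))\<^sup>2 \<le> energy_scale t x"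
  "(norm (y t x))\<^sup>2 \<le> energy_scale t x"
  by (simp_all add: energy_scale_def)

lemma norm_mult_le_energy_scale:
  fixes u :: "'b::real_normed_vector" and v :: "'c::real_normed_vector"
  assumes "(norm u)\<^sup>2 \<le> energy_scale s x" "(norm v)\<^sup>2 \<le> energy_scale t x"
  shows "norm u * norm v \<le> energy_scale s x + energy_scale t x"
proof -
  have "norm u * norm v \<le> (norm u)\<^sup>2 + (norm v)\<^sup>2"
    using sum_squares_bound[of "norm u" "norm v"] zero_le_power2[of "norm u"] zero_le_power2[of "norm v"]
    by linarith
  then show ?thesis using assms by linarith
qed

lemma correlation_bounds:
  assumes "a \<in> Basis"
  shows "norm ((f s x \<bullet> a) *\<^sub>R f t x) \<le> energy_scale s x + energy_scale t x"
    and "norm ((f s x \<bullet> a) *\<^sub>R z t x) \<le> energy_scale s x + energy_scale t x"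
    and "norm ((f s x \<bullet> a) *\<^sub>R y t x) \<le> energy_scale s x + energy_scale t x"
proof -
  have "(norm (f s x \<bullet> a))\<^sup>2 \<le> (norm (f s x))\<^sup>2"
    using assms by (intro power_mono) (auto simp: Basis_le_norm)
  then have "(norm (f s x \<bullet> a))\<^sup>2 \<le> energy_scale s x"
    using norm_le_energy_scale(1)[of s x] by linarith
  note norm_mult_le_energy_scale[OF this]
  note this[OF norm_le_energy_scale(1)] this[OF norm_le_energy_scale(2)] this[OF norm_le_energy_scale(3)]
  then show "norm ((f s x \<bullet> a) *\<^sub>R f t x) \<le> energy_scale s x + energy_scale t x"
    "norm ((f s x \<bullet> a) *\<^sub>R z t x) \<le> energy_scale s x + energy_scale t x"
    "norm ((f s x \<bullet> a) *\<^sub>R y t x) \<le> energy_scale s x + energy_scale t x"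
    by auto
qed

lemma integrable_correlation:
  assumes "a \<in> Basis" "s \<ge> 0" "t \<ge> 0"
  shows "integrable M (\<lambda>x. (f s x \<bullet> a) *\<^sub>R f t x)"
    and "integrable M (\<lambda>x. (f s x \<bullet> a) *\<^sub>R z t x)"
    and "integrable M (\<lambda>x. (f s x \<bullet> a) *\<^sub>R y t x)"
proof -
  note b = correlation_bounds[OF assms(1), of s _ t]
  show "integrable M (\<lambda>x. (f s x \<bullet> a) *\<^sub>R f t x)"
    using assms b(1) by (intro integrable_quadratic[of _ 1 s t]) simp_all
  show "integrable M (\<lambda>x. (f s x \<bullet> a) *\<^sub>R z t x)"
    using assms b(2) by (intro integrable_quadratic[of _ 1 s t]) simp_all
  show "integrable M (\<lambda>x. (f s x \<bullet> a) *\<^sub>R y t x)"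
    using assms b(3) by (intro integrable_quadratic[of _ 1 s t]) simp_all
qed

lemma noise_velocity_correlation:
  assumes T: "T \<ge> 0" and a: "a \<in> Basis"
    and C: "(1 / \<tau>\<^sup>2 + \<gamma> / \<tau>) *\<^sub>R C + A C = R a"
  shows "norm ((\<integral>x. (f T x \<bullet> a) *\<^sub>R z T x \<partial>M) - (1 / \<tau>) *\<^sub>R C)
    \<le> exp (- T / \<tau>) * sqrt (C \<bullet> C / \<tau>\<^sup>2 + C \<bullet> A C)"
proof -
  let ?B = "2 * moment_bound"
  note B = nn_integral_quadratic_bound
  define V where "V t = (\<integral>x. (f T x \<bullet> a) *\<^sub>R z t x \<partial>M)" for t
  define U where "U t = (\<integral>x. (f T x \<bullet> a) *\<^sub>R y t x \<partial>M)" for t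
  define g where "g t = exp (- (T - t) / \<tau>) *\<^sub>R R a - \<gamma> *\<^sub>R V t - A (U t)" for t
  note b = correlation_bounds[OF a, of T]
  have [measurable]: "f T \<in> borel_measurable M" by simp
  have sf: "sigma_finite_measure M" ..
  have UV: "(V has_integral U t) {0..t}" if t: "t \<in> {0..T}" for t
    unfolding U_def V_def
  proof (rule has_integral_expectation_derivative[OF sf, where B = "1 * ?B"])
    show "(\<integral>\<^sup>+x. ennreal (norm ((f T x \<bullet> a) *\<^sub>R z s x)) \<partial>M) \<le> ennreal (1 * ?B)" if "s \<in> {0..t}" for s
      using that T b(2) by (intro B[of 1 T s]) simp_all
    show "((\<lambda>s. (f T x \<bullet> a) *\<^sub>R y s x) has_vector_derivative (f T x \<bullet> a) *\<^sub>R z s x) (at s within {0..t})"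
      if "x \<in> space M" "s \<in> {0..t}" for s x
      using that
      by (intro bounded_linear.has_vector_derivative[OF bounded_linear_scaleR_right] y_deriv_Icc) auto
  qed (use t init in auto)
  have gE: "g s = (\<integral>x. (f T x \<bullet> a) *\<^sub>R (f s x - \<gamma> *\<^sub>R z s x - A (y s x)) \<partial>M)" if s: "s \<in> {0..T}" for s
  proof -
    have A_scale: "(f T x \<bullet> a) *\<^sub>R A (y s x) = A ((f T x \<bullet> a) *\<^sub>R y s x)" for x
      using linear_A by (simp add: linear_scale)
    have int: "integrable M (\<lambda>x. (f T x \<bullet> a) *\<^sub>R f s x)" "integrable M (\<lambda>x. (f T x \<bullet> a) *\<^sub>R z s x)"
      "integrable M (\<lambda>x. (f T x \<bullet> a) *\<^sub>R y s x)"
      using integrable_correlation[OF a T] s by auto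
    have "(\<integral>x. (f T x \<bullet> a) *\<^sub>R (f s x - \<gamma> *\<^sub>R z s x - A (y s x)) \<partial>M)
      = (\<integral>x. (f T x \<bullet> a) *\<^sub>R f s x - \<gamma> *\<^sub>R ((f T x \<bullet> a) *\<^sub>R z s x) - A ((f T x \<bullet> a) *\<^sub>R y s x) \<partial>M)"
      unfolding A_scale[symmetric] by (simp add: scaleR_diff_right mult.commute)
    also have "\<dots> = (\<integral>x. (f T x \<bullet> a) *\<^sub>R f s x \<partial>M) - \<gamma> *\<^sub>R V s - A (U s)"
      unfolding U_def V_def integral_bounded_linear[OF bounded_linear_A int(3), symmetric]
        integral_scaleR_right[symmetric]
      by (simp only: int Bochner_Integration.integral_diff Bochner_Integration.integrable_diff
          integrable_scaleR_right integrable_bounded_linear[OF bounded_linear_A int(3)])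
    finally have g_eq: "(\<integral>x. (f T x \<bullet> a) *\<^sub>R (f s x - \<gamma> *\<^sub>R z s x - A (y s x)) \<partial>M)
      = (\<integral>x. (f T x \<bullet> a) *\<^sub>R f s x \<partial>M) - \<gamma> *\<^sub>R V s - A (U s)" .
    \<comment> \<open>On \<open>{0..T}\<close> the kink of the covariance is reached only at the end
      point, so the forcing is a pure exponential.\<close>
    have "0 \<le> s" "\<bar>T - s\<bar> = T - s" using s by auto
    then show ?thesis
      unfolding g_eq f_covariance[OF T \<open>0 \<le> s\<close> a] by (simp only: g_def)
  qed
  have Vg: "(g has_integral V t) {0..t}" if t: "t \<in> {0..T}" for t
  proof -
    have "((\<lambda>s. \<integral>x. (f T x \<bullet> a) *\<^sub>R (f s x - \<gamma> *\<^sub>R z s x - A (y s x)) \<partial>M) has_integral V t) {0..t}"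
      unfolding V_def
    proof (rule has_integral_expectation_derivative[OF sf, where B = "(1 + \<gamma> + onorm A) * ?B"])
      let ?c = "1 + \<gamma> + onorm A"
      have o: "onorm A \<ge> 0" using bounded_linear_A by (rule onorm_pos_le)
      show "(\<integral>\<^sup>+x. ennreal (norm ((f T x \<bullet> a) *\<^sub>R (f s x - \<gamma> *\<^sub>R z s x - A (y s x)))) \<partial>M)
          \<le> ennreal (?c * ?B)" if "s \<in> {0..t}" for s
      proof (rule B[of _ T s])
        fix x
        let ?p = "\<bar>f T x \<bullet> a\<bar>" and ?E = "energy_scale T x + energy_scale s x"
        have "norm (f s x - \<gamma> *\<^sub>R z s x - A (y s x)) \<le> norm (f s x) + norm (\<gamma> *\<^sub>R z s x) + norm (A (y s x))"
          by (meson add_right_mono norm_triangle_ineq4 order_trans)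
        also have "\<dots> \<le> norm (f s x) + \<gamma> * norm (z s x) + onorm A * norm (y s x)"
          using \<gamma>_pos onorm[OF bounded_linear_A, of "y s x"] by simp
        finally have "?p * norm (f s x - \<gamma> *\<^sub>R z s x - A (y s x))
          \<le> ?p * (norm (f s x) + \<gamma> * norm (z s x) + onorm A * norm (y s x))"
          by (rule mult_left_mono) simp
        also have "\<dots> = ?p * norm (f s x) + \<gamma> * (?p * norm (z s x)) + onorm A * (?p * norm (y s x))"
          by (simp add: algebra_simps)
        also have "\<dots> \<le> ?E + \<gamma> * ?E + onorm A * ?E"
          using b[of x s] \<gamma>_pos o by (intro add_mono mult_left_mono) auto
        also have "\<dots> = ?c * ?E" by (simp add: algebra_simps)
        finally show "norm ((f T x \<bullet> a) *\<^sub>R (f s x - \<gamma> *\<^sub>R z s x - A (y s x))) \<le> ?c * ?E"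
          unfolding norm_scaleR real_norm_def .
      qed (use that T \<gamma>_pos o in auto)
      show "((\<lambda>s. (f T x \<bullet> a) *\<^sub>R z s x) has_vector_derivative
          (f T x \<bullet> a) *\<^sub>R (f s x - \<gamma> *\<^sub>R z s x - A (y s x))) (at s within {0..t})"
        if "x \<in> space M" "s \<in> {0..t}" for s x
        using that
        by (intro bounded_linear.has_vector_derivative[OF bounded_linear_scaleR_right] z_deriv_Icc) auto
    qed (use t init in auto)
    then show ?thesis
      by (rule has_integral_eq[rotated]) (use gE t in auto)
  qed
  \<comment> \<open>So far \<open>U\<close> and \<open>V\<close> are only known to satisfy integral
    equations. These make them continuous, hence \<open>g\<close> is continuous, and both equations
    can be differentiated.\<close>
  have contV: "continuous_on {0..T} V"
    using Vg by (rule continuous_on_indefinite_has_integral)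
  have contU: "continuous_on {0..T} U"
    using UV by (rule continuous_on_indefinite_has_integral)
  have contg: "continuous_on {0..T} g"
    unfolding g_def using \<tau>_pos contU contV
    by (intro continuous_intros linear_continuous_on_compose[OF contU linear_A]) auto
  have "norm (V T - (1 / \<tau>) *\<^sub>R C) \<le> exp (- T / \<tau>) * sqrt (C \<bullet> C / \<tau>\<^sup>2 + C \<bullet> A C)"
  proof (rule forced_response_bound[OF T \<tau>_pos _ _ _ _ C])
    show "(U has_vector_derivative V t) (at t within {0..T})" if "t \<in> {0..T}" for t
      using UV contV that by (rule indefinite_has_integral_has_vector_derivative)
    show "(V has_vector_derivative exp (- (T - t) / \<tau>) *\<^sub>R R a - \<gamma> *\<^sub>R V t - A (U t)) (at t within {0..T})"
      if "t \<in> {0..T}" for t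
      using indefinite_has_integral_has_vector_derivative[OF Vg contg that] by (simp add: g_def)
    show "U 0 = 0" "V 0 = 0"
      using UV[of 0] Vg[of 0] T by (auto simp: has_integral_refl dest: has_integral_unique)
  qed
  then show ?thesis by (simp add: V_def)
qed

section \<open>Mean energy balance and the long-time average\<close>

definition input_power :: "real \<Rightarrow> real"
  where "input_power t = (\<integral>x. f t x \<bullet> z t x \<partial>M)"

text \<open>Expanding the inner product in the standard basis reduces the claim to
  \<open>noise_velocity_correlation\<close> with equal times. The exponential decay keeps the time
  integral of the error bounded, so that it disappears from the long-time average.\<close>

lemma input_power_bound:
  assumes C: "\<And>a. a \<in> Basis \<Longrightarrow> (1 / \<tau>\<^sup>2 + \<gamma> / \<tau>) *\<^sub>R C a + A (C a) = R a"
  obtains K where "K \<ge> 0" and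
    "\<And>t. t \<ge> 0 \<Longrightarrow> \<bar>input_power t - (\<Sum>a\<in>Basis. C a \<bullet> a) / \<tau>\<bar> \<le> K * exp (- t / \<tau>)"
proof (rule that)
  let ?K = "\<lambda>a. sqrt (C a \<bullet> C a / \<tau>\<^sup>2 + C a \<bullet> A (C a))"
  show "0 \<le> (\<Sum>a\<in>Basis. ?K a)"
    by (intro sum_nonneg real_sqrt_ge_zero add_nonneg_nonneg A_nonneg) auto
  fix t :: real assume t: "t \<ge> 0"
  let ?V = "\<lambda>a. \<integral>x. (f t x \<bullet> a) *\<^sub>R z t x \<partial>M"
  have "f t x \<bullet> z t x = (\<Sum>a\<in>Basis. ((f t x \<bullet> a) *\<^sub>R z t x) \<bullet> a)" for x
    by (subst euclidean_inner) simp
  then have "input_power t = (\<Sum>a\<in>Basis. ?V a \<bullet> a)"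
    using integrable_correlation(2)[OF _ t t]
    by (simp add: input_power_def Bochner_Integration.integral_sum del: inner_scaleR_left)
  then have "input_power t - (\<Sum>a\<in>Basis. C a \<bullet> a) / \<tau> = (\<Sum>a\<in>Basis. (?V a - (1 / \<tau>) *\<^sub>R C a) \<bullet> a)"
    by (simp add: inner_diff_left sum_subtractf sum_divide_distrib)
  also have "\<bar>\<dots>\<bar> \<le> (\<Sum>a\<in>Basis. exp (- t / \<tau>) * ?K a)"
  proof (rule order_trans[OF sum_abs], rule sum_mono)
    fix a :: 'e assume a: "a \<in> Basis"
    show "\<bar>(?V a - (1 / \<tau>) *\<^sub>R C a) \<bullet> a\<bar> \<le> exp (- t / \<tau>) * ?K a"
      by (rule order_trans[OF Basis_le_norm[OF a] noise_velocity_correlation[OF t a C[OF a]]])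
  qed
  also have "\<dots> = (\<Sum>a\<in>Basis. ?K a) * exp (- t / \<tau>)"
    by (simp add: sum_distrib_left mult.commute)
  finally show "\<bar>input_power t - (\<Sum>a\<in>Basis. C a \<bullet> a) / \<tau>\<bar> \<le> (\<Sum>a\<in>Basis. ?K a) * exp (- t / \<tau>)" .
qed

text \<open>
  Energy balance: up to the bounded stored energy, the dissipated energy equals the work done by
  the noise.
\<close>

lemma mean_dissipation_tendsto:
  assumes C: "\<And>a. a \<in> Basis \<Longrightarrow> (1 / \<tau>\<^sup>2 + \<gamma> / \<tau>) *\<^sub>R C a + A (C a) = R a"
  shows "((\<lambda>T. (1 / T) * (\<integral>x. (LBINT t:{0..T}. \<gamma> * (z t x \<bullet> z t x)) \<partial>M)) \<longlongrightarrow>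
    (\<Sum>a\<in>Basis. C a \<bullet> a) / \<tau>) at_top"
proof -
  let ?q = "(\<Sum>a\<in>Basis. C a \<bullet> a) / \<tau>"
  let ?D = "\<lambda>T. \<integral>x. (LBINT t:{0..T}. \<gamma> * (z t x \<bullet> z t x)) \<partial>M"
  obtain K where K: "K \<ge> 0" "\<And>t. t \<ge> 0 \<Longrightarrow> \<bar>input_power t - ?q\<bar> \<le> K * exp (- t / \<tau>)"
    using input_power_bound[OF C] by metis
  let ?B = "2 * moment_bound"
  note B = nn_integral_quadratic_bound
  have sf: "sigma_finite_measure M" ..
  have o: "onorm A \<ge> 0" using bounded_linear_A by (rule onorm_pos_le)
  \<comment> \<open>Both times of the quadratic bound are set to \<open>t\<close>, hence the doubled
    \<open>energy_scale t x\<close> here and below.\<close>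
  have zz: "norm (\<gamma> * (z t x \<bullet> z t x)) \<le> \<gamma> * (energy_scale t x + energy_scale t x)" for t x
  proof -
    have "z t x \<bullet> z t x \<le> energy_scale t x + energy_scale t x"
      unfolding energy_scale_def by (simp add: power2_norm_eq_inner)
    then show ?thesis using \<gamma>_pos by (simp add: mult_left_mono)
  qed
  have fz: "norm (f t x \<bullet> z t x) \<le> energy_scale t x + energy_scale t x" for t x
    using Cauchy_Schwarz_ineq2[of "f t x" "z t x"]
      norm_mult_le_energy_scale[OF norm_le_energy_scale(1,2), of t x t] by simp
  have energy: "\<bar>(z t x \<bullet> z t x + y t x \<bullet> A (y t x)) / 2\<bar>
      \<le> (1 + onorm A) * (energy_scale t x + energy_scale t x)" for t x
  proof -
    have "y t x \<bullet> A (y t x) \<le> norm (y t x) * norm (A (y t x))" by (rule norm_cauchy_schwarz)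
    also have "\<dots> \<le> norm (y t x) * (onorm A * norm (y t x))"
      by (intro mult_left_mono onorm[OF bounded_linear_A]) simp
    also have "\<dots> = onorm A * (norm (y t x))\<^sup>2" by (simp add: power2_eq_square)
    also have "\<dots> \<le> onorm A * energy_scale t x"
      by (intro mult_left_mono norm_le_energy_scale o)
    finally have "z t x \<bullet> z t x + y t x \<bullet> A (y t x) \<le> (1 + onorm A) * energy_scale t x"
      using norm_le_energy_scale(2)[of t x] by (simp add: power2_norm_eq_inner algebra_simps)
    moreover have "0 \<le> energy_scale t x" by (simp add: energy_scale_def)
    then have "0 \<le> (1 + onorm A) * energy_scale t x" using o by simp
    moreover have "0 \<le> z t x \<bullet> z t x + y t x \<bullet> A (y t x)" by (simp add: A_nonneg)
    moreover have "(1 + onorm A) * (energy_scale t x + energy_scale t x) =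
      (1 + onorm A) * energy_scale t x + (1 + onorm A) * energy_scale t x" by (rule distrib_left)
    moreover have "0 \<le> p \<Longrightarrow> p \<le> q \<Longrightarrow> \<bar>p / 2\<bar> \<le> q + q" for p q :: real by simp
    ultimately show ?thesis by (simp only:)
  qed
  let ?S = "(1 + onorm A) * ?B"
  \<comment> \<open>Both errors are bounded in \<open>T\<close>: the mean stored energy is at most
    \<open>?S\<close>, and the accumulated deviation of the input power from \<open>?q\<close> is at
    most \<open>K * \<tau>\<close>. Division by \<open>T\<close> then gives the limit.\<close>
  have main: "\<bar>?D T - ?q * T\<bar> \<le> K * \<tau> + ?S" if T: "T \<ge> 0" for T
  proof -
    let ?E = "\<integral>x. (z T x \<bullet> z T x + y T x \<bullet> A (y T x)) / 2 \<partial>M"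
    have E_bounds: "0 \<le> ?E" "?E \<le> ?S"
    proof -
      show "0 \<le> ?E" by (intro Bochner_Integration.integral_nonneg) (simp add: A_nonneg)
      have "(\<integral>\<^sup>+x. ennreal ((z T x \<bullet> z T x + y T x \<bullet> A (y T x)) / 2) \<partial>M) \<le> ennreal ?S"
        using energy[of T] o T by (intro B[of _ T T]) (auto simp: abs_le_iff)
      then show "?E \<le> ?S"
        using moment_bound_nonneg o A_nonneg by (intro integral_real_bounded) auto
    qed
    have bal: "((\<lambda>t. \<integral>x. f t x \<bullet> z t x - \<gamma> * (z t x \<bullet> z t x) \<partial>M) has_integral ?E) {0..T}"
    proof (rule has_integral_expectation_derivative[OF sf T, where B = "(1 + \<gamma>) * ?B"])
      show "(\<integral>\<^sup>+x. ennreal (norm (f t x \<bullet> z t x - \<gamma> * (z t x \<bullet> z t x))) \<partial>M) \<le> ennreal ((1 + \<gamma>) * ?B)"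
        if "t \<in> {0..T}" for t
      proof (rule B[of _ t t])
        show "norm (f t x \<bullet> z t x - \<gamma> * (z t x \<bullet> z t x)) \<le> (1 + \<gamma>) * (energy_scale t x + energy_scale t x)" for x
          using norm_triangle_ineq4[of "f t x \<bullet> z t x" "\<gamma> * (z t x \<bullet> z t x)"] fz[of t x] zz[of t x]
          by (simp add: algebra_simps)
      qed (use that \<gamma>_pos in auto)
      show "((\<lambda>t. (z t x \<bullet> z t x + y t x \<bullet> A (y t x)) / 2) has_vector_derivative
          f t x \<bullet> z t x - \<gamma> * (z t x \<bullet> z t x)) (at t within {0..T})"
        if "x \<in> space M" "t \<in> {0..T}" for t x
        using that by (intro energy_has_vector_derivative y_deriv_Icc z_deriv_Icc) auto
    qed (use init linear_A in \<open>auto simp: linear_0\<close>)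
    have diss: "((\<lambda>t. \<integral>x. \<gamma> * (z t x \<bullet> z t x) \<partial>M) has_integral ?D T) {0..T}"
    proof (rule expectation_strip_Fubini(3)[OF sf, where B = "\<gamma> * ?B"])
      show "(\<integral>\<^sup>+x. ennreal (norm (\<gamma> * (z t x \<bullet> z t x))) \<partial>M) \<le> ennreal (\<gamma> * ?B)" if "t \<in> {0..T}" for t
        using zz[of t] \<gamma>_pos that by (intro B[of _ t t]) auto
    qed measurable
    have split: "(\<integral>x. f t x \<bullet> z t x - \<gamma> * (z t x \<bullet> z t x) \<partial>M) + (\<integral>x. \<gamma> * (z t x \<bullet> z t x) \<partial>M) = input_power t"
      if "t \<in> {0..T}" for t
    proof -
      have "integrable M (\<lambda>x. f t x \<bullet> z t x)"
        using that fz by (intro integrable_quadratic[of _ 1 t t]) auto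
      moreover have "integrable M (\<lambda>x. \<gamma> * (z t x \<bullet> z t x))"
        using that zz \<gamma>_pos by (intro integrable_quadratic[of _ \<gamma> t t]) auto
      ultimately show ?thesis
        by (simp add: input_power_def Bochner_Integration.integral_diff)
    qed
    have "(input_power has_integral (?E + ?D T)) {0..T}"
      by (rule has_integral_eq[OF split has_integral_add[OF bal diss]])
    moreover have "((\<lambda>t. ?q) has_integral ?q * T) {0..T}"
      using has_integral_const_real[of ?q 0 T] T by (simp add: mult.commute)
    ultimately have diff: "((\<lambda>t. input_power t - ?q) has_integral (?E + ?D T - ?q * T)) {0..T}"
      by (rule has_integral_diff)
    have exp_int: "((\<lambda>t. K * exp (- t / \<tau>)) has_integral
        (- K * \<tau> * exp (- T / \<tau>) - (- K * \<tau> * exp (- 0 / \<tau>)))) {0..T}"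
      using T \<tau>_pos
      by (intro fundamental_theorem_of_calculus)
        (auto intro!: derivative_eq_intros simp flip: has_real_derivative_iff_has_vector_derivative)
    have "norm (integral {0..T} (\<lambda>t. input_power t - ?q)) \<le> integral {0..T} (\<lambda>t. K * exp (- t / \<tau>))"
      by (rule integral_norm_bound_integral) (use diff exp_int K(2) in auto)
    then have "norm (?E + ?D T - ?q * T) \<le> - K * \<tau> * exp (- T / \<tau>) - (- K * \<tau> * exp (- 0 / \<tau>))"
      by (simp only: integral_unique[OF diff] integral_unique[OF exp_int])
    also have "\<dots> \<le> K * \<tau>" using K(1) \<tau>_pos by simp
    finally show ?thesis using E_bounds by (simp add: abs_le_iff)
  qed
  have "((\<lambda>T. (K * \<tau> + ?S) / T) \<longlongrightarrow> 0) at_top"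
    by (rule real_tendsto_divide_at_top[OF tendsto_const filterlim_ident])
  then have "((\<lambda>T. (1 / T) * ?D T - ?q) \<longlongrightarrow> 0) at_top"
  proof (rule Lim_null_comparison[rotated])
    show "eventually (\<lambda>T. norm ((1 / T) * ?D T - ?q) \<le> (K * \<tau> + ?S) / T) at_top"
      using eventually_gt_at_top[of 0]
    proof eventually_elim
      case (elim T)
      have "(1 / T) * ?D T - ?q = (?D T - ?q * T) / T" using elim by (simp add: diff_divide_distrib)
      then show ?case using main[of T] elim by (simp add: divide_right_mono)
    qed
  qed
  then show ?thesis by (rule LIM_zero_cancel)
qed

end

subsection \<open>Reduction of the network dynamics\<close>

text \<open>A prescribed covariance does not show that a product is integrable, since the Bochner
  integral of a nonintegrable function is 0. Integrability is therefore taken from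
  Gaussianity.\<close>

lemma gaussian_rv_square_integrable:
  assumes "prob_space M" and "gaussian_rv M X"
  shows "integrable M (\<lambda>x. (X x)\<^sup>2)"
proof -
  interpret prob_space M by fact
  have [measurable]: "X \<in> borel_measurable M"
    using assms(2) by (simp add: gaussian_rv_def)
  obtain \<mu> where "(AE x in M. X x = \<mu>) \<or> (\<exists>\<sigma>>0. distributed M lborel X (normal_density \<mu> \<sigma>))"
    using assms(2) by (auto simp: gaussian_rv_def)
  then show ?thesis
  proof
    assume "AE x in M. X x = \<mu>"
    then have "AE x in M. (X x)\<^sup>2 = \<mu>\<^sup>2" by eventually_elim simp
    then show ?thesis
      by (subst integrable_cong_AE[where g = "\<lambda>_. \<mu>\<^sup>2"]) auto
  next
    assume "\<exists>\<sigma>>0. distributed M lborel X (normal_density \<mu> \<sigma>)"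
    then obtain \<sigma> where \<sigma>: "\<sigma> > 0" and D: "distributed M lborel X (normal_density \<mu> \<sigma>)" by blast
    \<comment> \<open>\<open>integrable_normal_moment\<close> speaks of centred moments, so
      \<open>x\<^sup>2\<close> is expanded in powers of \<open>x - \<mu>\<close>.\<close>
    have "normal_density \<mu> \<sigma> x * x\<^sup>2 = normal_density \<mu> \<sigma> x * (x - \<mu>) ^ 2 +
        2 * \<mu> * (normal_density \<mu> \<sigma> x * (x - \<mu>) ^ 1) + \<mu>\<^sup>2 * (normal_density \<mu> \<sigma> x * (x - \<mu>) ^ 0)" for x
      by (simp add: power2_eq_square algebra_simps)
    moreover have "integrable lborel (\<lambda>x. normal_density \<mu> \<sigma> x * (x - \<mu>) ^ 2 +
        2 * \<mu> * (normal_density \<mu> \<sigma> x * (x - \<mu>) ^ 1) + \<mu>\<^sup>2 * (normal_density \<mu> \<sigma> x * (x - \<mu>) ^ 0))"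
      by (intro Bochner_Integration.integrable_add integrable_mult_right integrable_normal_moment \<sigma>)
    ultimately have "integrable lborel (\<lambda>x. normal_density \<mu> \<sigma> x * x\<^sup>2)" by simp
    then show ?thesis
      using distributed_integrable[OF D, of "\<lambda>x. x\<^sup>2"] by simp
  qed
qed

text \<open>A limit along a sequence keeps measurability, which is how the acceleration becomes
  measurable. The increments are positive, so the quotients stay inside \<open>{0..}\<close> also at
  \<open>t = 0\<close>.\<close>

lemma difference_quotients_tendsto:
  fixes u :: "real \<Rightarrow> 'e::real_normed_vector"
  assumes "(u has_vector_derivative u') (at t within {0..})" and "t \<ge> 0"
  shows "(\<lambda>n. real (Suc n) *\<^sub>R (u (t + 1 / real (Suc n)) - u t)) \<longlonglongrightarrow> u'"
proof -
  let ?s = "\<lambda>n. t + 1 / real (Suc n)"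
  have "((\<lambda>s. (1 / norm (s - t)) *\<^sub>R (u s - (u t + (s - t) *\<^sub>R u'))) \<longlongrightarrow> 0) (at t within {0..})"
    using assms(1) by (simp add: has_vector_derivative_def has_derivative_within)
  moreover have "filterlim ?s (at t within {0..}) sequentially"
  proof -
    have "?s \<longlonglongrightarrow> t + 0"
      by (intro tendsto_intros LIMSEQ_Suc[OF lim_1_over_n])
    then show ?thesis
      using assms(2) by (auto simp: filterlim_at intro!: always_eventually)
  qed
  ultimately have "(\<lambda>n. (1 / norm (?s n - t)) *\<^sub>R (u (?s n) - (u t + (?s n - t) *\<^sub>R u'))) \<longlonglongrightarrow> 0"
    by (rule filterlim_compose)
  moreover have "(1 / norm (?s n - t)) *\<^sub>R (u (?s n) - (u t + (?s n - t) *\<^sub>R u'))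
      = real (Suc n) *\<^sub>R (u (?s n) - u t) - u'" for n
    by (simp add: scaleR_diff_right scaleR_add_right del: of_nat_Suc)
  ultimately show ?thesis
    by (simp add: LIM_zero_iff del: of_nat_Suc)
qed

text \<open>Along \<open>u + s *\<^sub>R w\<close> with \<open>w = L *v u\<close> the quadratic form
  is \<open>2 * s * p + s\<^sup>2 * q\<close>. Unless \<open>w = 0\<close>, the linear term makes it
  negative for small negative \<open>s\<close>.\<close>

lemma psd_inner_zero_imp:
  fixes L :: "real ^ 'n ^ 'n"
  assumes L: "positive_semidefinite L" and u: "u \<bullet> (L *v u) = 0"
  shows "L *v u = 0"
proof (rule ccontr)
  assume nz: "L *v u \<noteq> 0"
  define w where "w = L *v u"
  define p where "p = w \<bullet> w"
  define q where "q = w \<bullet> (L *v w)"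
  have sym: "a \<bullet> (L *v c) = c \<bullet> (L *v a)" for a c
    using L dot_lmul_matrix[of a L c] by (simp add: positive_semidefinite_def inner_commute flip: transpose_matrix_vector)
  have p: "p > 0" using nz by (simp add: p_def w_def)
  have q: "q \<ge> 0" using L by (simp add: positive_semidefinite_def q_def)
  have quad: "0 \<le> 2 * s * p + s\<^sup>2 * q" for s
  proof -
    have "0 \<le> (u + s *\<^sub>R w) \<bullet> (L *v (u + s *\<^sub>R w))"
      using L by (simp add: positive_semidefinite_def)
    also have "\<dots> = 2 * s * p + s\<^sup>2 * q"
      using u sym[of u w]
      by (simp add: matrix_vector_right_distrib matrix_vector_mult_scaleR inner_add_left inner_add_right
          p_def q_def w_def[symmetric] power2_eq_square algebra_simps)
    finally show ?thesis .
  qed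
  \<comment> \<open>The near-minimizer has \<open>q + 1\<close> in the denominator instead of
    \<open>q\<close>, which also covers \<open>q = 0\<close>.\<close>
  have "2 * (- (p / (q + 1))) * p + (- (p / (q + 1)))\<^sup>2 * q = - (p\<^sup>2 * (q + 2)) / (q + 1)\<^sup>2"
    using q by (simp add: divide_simps power2_eq_square) (simp add: algebra_simps)
  moreover have "p\<^sup>2 * (q + 2) / (q + 1)\<^sup>2 > 0"
    using p q by (intro divide_pos_pos mult_pos_pos) auto
  ultimately show False using quad[of "- (p / (q + 1))"] by simp
qed

text \<open>The dampings are represented by \<open>\<gamma> * m $ i\<close>, so damping-weighted
  averages become mass-weighted ones.\<close>

locale network =
  fixes L :: "real ^ 'n ^ 'n" and m :: "real ^ 'n" and \<gamma> :: real
  assumes m_pos: "\<And>i. m $ i > 0" and \<gamma>_pos: "\<gamma> > 0"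
    and psd: "positive_semidefinite L" and L_ones: "L *v (\<chi> i. 1) = 0"
    and simple: "simple_eigenvalue L 0"
begin

section \<open>Mass-weighted coordinates and the stiffness operator\<close>

lemma L_sym: "u \<bullet> (L *v v) = (L *v u) \<bullet> v"
  using psd dot_lmul_matrix[of u L v]
  by (simp add: positive_semidefinite_def flip: transpose_matrix_vector)

definition total :: real
  where "total = (\<Sum>i\<in>UNIV. m $ i)"

definition wmean :: "real ^ 'n \<Rightarrow> real"
  where "wmean u = (\<Sum>j\<in>UNIV. m $ j * u $ j) / total"

text \<open>Mass-weighted coordinates of the deviation from the network average.\<close>

definition scaled :: "real ^ 'n \<Rightarrow> real ^ 'n"
  where "scaled u = (\<chi> i. sqrt (m $ i) * (u $ i - wmean u))"

text \<open>Multiplication by the inverse square root of the mass matrix;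
  \<open>unscale (L *v unscale u)\<close> is the mass-weighted Laplacian applied to
  \<open>u\<close>.\<close>

definition unscale :: "real ^ 'n \<Rightarrow> real ^ 'n"
  where "unscale u = (\<chi> i. u $ i / sqrt (m $ i))"

text \<open>The zero mode of the mass-weighted Laplacian, since \<open>unscale\<close> maps it to
  the constant vector.\<close>

definition root :: "real ^ 'n"
  where "root = (\<chi> i. sqrt (m $ i))"

text \<open>
  The rank-one term removes the zero eigenvalue; it does not act on deviations, which are
  orthogonal to \<open>root\<close>.
\<close>

definition stiffness :: "real ^ 'n \<Rightarrow> real ^ 'n"
  where "stiffness u = unscale (L *v unscale u) + (root \<bullet> u) *\<^sub>R root"

text \<open>Unit power at node \<open>i\<close> accelerates it by \<open>1 / m $ i\<close>; this is
  the resulting acceleration vector in the new coordinates.\<close>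

definition node :: "'n \<Rightarrow> real ^ 'n"
  where "node i = scaled (axis i (1 / m $ i))"

lemma m_nz [simp]: "m $ i \<noteq> 0" "sqrt (m $ i) \<noteq> 0" "sqrt (m $ i) * sqrt (m $ i) = m $ i"
  "\<bar>m $ i\<bar> = m $ i"
  using m_pos[of i] by auto

lemma root_mult: "sqrt (m $ i) * x * (sqrt (m $ i) * w) = m $ i * (x * w)"
proof -
  have "sqrt (m $ i) * x * (sqrt (m $ i) * w) = (sqrt (m $ i) * sqrt (m $ i)) * (x * w)"
    by (simp only: mult_ac)
  then show ?thesis by (simp only: m_nz(3))
qed

lemma total_pos: "total > 0"
  unfolding total_def by (intro sum_pos m_pos) auto

lemma linear_wmean: "linear wmean"
  by (rule linearI)
    (simp_all add: wmean_def sum.distrib distrib_left add_divide_distrib sum_distrib_left mult.left_commute)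

lemma linear_scaled: "linear scaled"
  using linear_wmean
  by (intro linearI) (simp_all add: scaled_def vec_eq_iff algebra_simps linear_add linear_scale)

lemma linear_unscale: "linear unscale"
  by (rule linearI) (simp_all add: unscale_def vec_eq_iff add_divide_distrib)

lemma unscale_inner: "unscale u \<bullet> v = u \<bullet> unscale v"
  by (simp add: unscale_def inner_vec_def)

lemma linear_stiffness: "linear stiffness"
  unfolding stiffness_def
  by (rule linearI) (simp_all add: linear_add[OF linear_unscale] linear_scale[OF linear_unscale]
      matrix_vector_right_distrib matrix_vector_mult_scaleR algebra_simps inner_add_right)

lemma stiffness_sym: "stiffness u \<bullet> v = u \<bullet> stiffness v"
proof -
  have "unscale (L *v unscale u) \<bullet> v = u \<bullet> unscale (L *v unscale v)"
    by (simp only: unscale_inner[of "L *v unscale u"] L_sym[symmetric] unscale_inner[of u])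
  then show ?thesis
    by (simp add: stiffness_def inner_add_left inner_add_right inner_commute)
qed

lemma stiffness_inner: "u \<bullet> stiffness u = unscale u \<bullet> (L *v unscale u) + (root \<bullet> u)\<^sup>2"
  by (simp add: stiffness_def inner_add_right power2_eq_square inner_commute[of root u] flip: unscale_inner)

text \<open>A one-dimensional kernel is spanned by any of its nonzero elements, here the constant
  vector.\<close>

lemma kernel_subset: "{u. L *v u = 0} \<subseteq> span {\<chi> i. 1}"
proof (rule card_ge_dim_independent)
  have "((\<chi> i. 1) :: real ^ 'n) \<noteq> 0" by (simp add: vec_eq_iff)
  then show "independent {(\<chi> i. 1) :: real ^ 'n}" by simp
qed (use L_ones simple in \<open>simp_all add: simple_eigenvalue_def\<close>)

text \<open>Both summands of \<open>stiffness_inner\<close> are nonnegative. If both vanish,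
  \<open>unscale u\<close> is constant, so \<open>u\<close> is a multiple of \<open>root\<close> and
  at the same time orthogonal to it.\<close>

lemma stiffness_pos:
  assumes "u \<noteq> 0"
  shows "u \<bullet> stiffness u > 0"
proof -
  have nonneg: "0 \<le> unscale u \<bullet> (L *v unscale u)"
    using psd by (simp add: positive_semidefinite_def)
  have "u \<bullet> stiffness u \<noteq> 0"
  proof
    assume "u \<bullet> stiffness u = 0"
    then have "unscale u \<bullet> (L *v unscale u) = 0" and r: "root \<bullet> u = 0"
      using nonneg unfolding stiffness_inner by (auto simp: add_nonneg_eq_0_iff)
    then have "unscale u \<in> span {\<chi> i. 1}"
      using psd_inner_zero_imp[OF psd] kernel_subset by auto
    then obtain c where "unscale u = c *\<^sub>R (\<chi> i. 1)"
      by (auto simp: span_singleton)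
    then have u: "u $ i = c * sqrt (m $ i)" for i
      by (simp add: unscale_def vec_eq_iff field_simps)
    then have "root \<bullet> u = c * total"
      by (simp add: root_def inner_vec_def total_def sum_distrib_left mult.left_commute)
    then have "c = 0" using r total_pos by simp
    then show False using u assms by (simp add: vec_eq_iff)
  qed
  then show ?thesis
    using nonneg unfolding stiffness_inner by (simp add: less_le)
qed

text \<open>Compactness of the unit sphere and homogeneity turn positivity into a uniform lower
  bound.\<close>

lemma stiffness_coercive: "\<exists>\<mu>>0. \<forall>u. \<mu> * (u \<bullet> u) \<le> u \<bullet> stiffness u"
proof -
  let ?S = "sphere (0 :: real ^ 'n) 1"
  have "continuous_on ?S (\<lambda>u. u \<bullet> stiffness u)"
    using linear_stiffness by (intro continuous_intros linear_continuous_on) (simp add: linear_conv_bounded_linear)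
  then obtain u0 where u0: "u0 \<in> ?S" "\<And>u. u \<in> ?S \<Longrightarrow> u0 \<bullet> stiffness u0 \<le> u \<bullet> stiffness u"
    using continuous_attains_inf[of ?S "\<lambda>u. u \<bullet> stiffness u"] by auto
  let ?\<mu> = "u0 \<bullet> stiffness u0"
  have "?\<mu> * (u \<bullet> u) \<le> u \<bullet> stiffness u" for u
  proof (cases "u = 0")
    case False
    let ?v = "(1 / norm u) *\<^sub>R u"
    have "?\<mu> \<le> ?v \<bullet> stiffness ?v" using False by (intro u0) simp
    also have "\<dots> = (u \<bullet> stiffness u) / (norm u)\<^sup>2"
      by (simp add: linear_scale[OF linear_stiffness] power2_eq_square)
    finally show ?thesis using False by (simp add: field_simps power2_norm_eq_inner)
  qed simp
  moreover have "?\<mu> > 0" using u0(1) by (intro stiffness_pos) auto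
  ultimately show ?thesis by blast
qed

section \<open>Decoupling of the deviations from the network average\<close>

lemma root_inner_scaled: "root \<bullet> scaled u = 0"
proof -
  have "sqrt (m $ i) * (sqrt (m $ i) * (u $ i - wmean u)) = m $ i * u $ i - wmean u * m $ i" for i
    unfolding mult.assoc[symmetric] m_nz(3) by (simp add: algebra_simps)
  then have "root \<bullet> scaled u = (\<Sum>i\<in>UNIV. m $ i * u $ i) - wmean u * total"
    by (simp add: root_def scaled_def inner_vec_def total_def sum_distrib_left sum_subtractf)
  then show ?thesis using total_pos by (simp add: wmean_def)
qed

lemma sum_L: "(\<Sum>i\<in>UNIV. (L *v u) $ i) = 0"
proof -
  have "(\<Sum>i\<in>UNIV. (L *v u) $ i) = (\<chi> i. 1) \<bullet> (L *v u)" by (simp add: inner_vec_def)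
  then show ?thesis by (simp add: L_sym L_ones)
qed

text \<open>\<open>L\<close> annihilates constants, so it does not see the average that
  \<open>scaled\<close> removes. The entries of \<open>L *v u\<close> sum to zero, so the
  acceleration they cause has mass-weighted mean zero. Hence the equation for the deviations is
  closed.\<close>

lemma stiffness_scaled: "stiffness (scaled u) = scaled (\<chi> i. (L *v u) $ i / m $ i)"
proof -
  have "unscale (scaled u) = u - wmean u *\<^sub>R (\<chi> i. 1)"
    by (simp add: unscale_def scaled_def vec_eq_iff)
  then have "L *v unscale (scaled u) = L *v u"
    by (simp add: matrix_vector_mult_diff_distrib matrix_vector_mult_scaleR L_ones)
  moreover have "scaled (\<chi> i. (L *v u) $ i / m $ i) = unscale (L *v u)"
    by (simp add: scaled_def unscale_def wmean_def sum_L vec_eq_iff field_simps)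
  ultimately show ?thesis by (simp add: stiffness_def root_inner_scaled)
qed

lemma scaled_sum_node: "scaled (\<chi> i. P $ i / m $ i) = (\<Sum>i\<in>UNIV. P $ i *\<^sub>R node i)"
proof -
  have "(\<chi> i. P $ i / m $ i) = (\<Sum>i\<in>UNIV. P $ i *\<^sub>R axis i (1 / m $ i))"
    by (simp add: vec_eq_iff axis_def sum.delta if_distrib cong: if_cong)
  then show ?thesis
    by (simp add: node_def linear_sum[OF linear_scaled] linear_scale[OF linear_scaled])
qed

text \<open>The source of the node weights in the theorem: \<open>axis i (1 / m $ i)\<close> has
  squared mass-weighted norm \<open>1 / m $ i\<close>, and its projection onto the constants, which
  \<open>scaled\<close> removes, has \<open>1 / total\<close>.\<close>

lemma node_inner_node: "node i \<bullet> node i = 1 / m $ i - 1 / total"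
proof -
  have w: "wmean (axis i (1 / m $ i)) = 1 / total"
    by (simp add: wmean_def axis_def if_distrib cong: if_cong)
  have "node i \<bullet> node i = (\<Sum>j\<in>UNIV. m $ j * ((if j = i then 1 / m $ i else 0) - 1 / total)\<^sup>2)"
    by (simp add: node_def scaled_def w inner_vec_def power2_eq_square root_mult)
      (simp add: axis_def)
  also have "\<dots> = (\<Sum>j\<in>UNIV. m $ j / total\<^sup>2 + (if j = i then 1 / m $ i - 2 / total else 0))"
    using total_pos by (intro sum.cong refl) (auto simp: power2_eq_square field_simps)
  also have "\<dots> = 1 / m $ i - 1 / total"
    using total_pos by (simp add: sum.distrib flip: sum_divide_distrib total_def) (simp add: power2_eq_square field_simps)
  finally show ?thesis .
qed

lemma diag_matrix_vector: "(diag_matrix v *v u) $ i = v $ i * u $ i"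
  by (simp add: diag_matrix_def matrix_vector_mult_def if_distrib if_distribR cong: if_cong)

text \<open>As damping is proportional to mass, \<open>average_frequency\<close> has all entries
  \<open>wmean u\<close>, and the square roots in \<open>scaled\<close> supply the masses.\<close>

lemma control_effort_scaled:
  assumes "\<And>i. d $ i = \<gamma> * m $ i"
  shows "(u - average_frequency d u) \<bullet> (diag_matrix d *v (u - average_frequency d u))
    = \<gamma> * (scaled u \<bullet> scaled u)"
proof -
  have "average_frequency d u = (\<chi> i. wmean u)"
    using \<gamma>_pos by (simp add: average_frequency_def assms wmean_def total_def mult.assoc flip: sum_distrib_left)
  then have "(u - average_frequency d u) \<bullet> (diag_matrix d *v (u - average_frequency d u))
      = (\<Sum>i\<in>UNIV. \<gamma> * (m $ i * ((u $ i - wmean u) * (u $ i - wmean u))))"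
    by (simp add: inner_vec_def diag_matrix_vector assms mult_ac)
  also have "\<dots> = \<gamma> * (scaled u \<bullet> scaled u)"
    by (simp add: scaled_def inner_vec_def root_mult sum_distrib_left)
  finally show ?thesis .
qed

end

text \<open>Measurability is given for nonnegative times only; clamping extends the process to all
  times without changing it there.\<close>

lemma measurable_process_clamped:
  assumes "measurable_process M X"
  shows "(\<lambda>(t, x). X (max 0 t) x) \<in> borel_measurable (borel \<Otimes>\<^sub>M M)"
proof -
  have "(\<lambda>t. max 0 t :: real) \<in> borel \<rightarrow>\<^sub>M restrict_space borel {0..}"
    by (intro measurable_restrict_space2) auto
  then have "(\<lambda>p. (max 0 (fst p :: real), snd p)) \<in> borel \<Otimes>\<^sub>M M \<rightarrow>\<^sub>M restrict_space borel {0..} \<Otimes>\<^sub>M M"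
    by (intro measurable_Pair measurable_compose[OF measurable_fst] measurable_snd)
  from measurable_compose[OF this assms[unfolded measurable_process_def]]
  show ?thesis by (simp add: case_prod_unfold)
qed

lemma integrable_mult_square:
  fixes X Y :: "'a \<Rightarrow> real"
  assumes [measurable]: "X \<in> borel_measurable M" "Y \<in> borel_measurable M"
    and "integrable M (\<lambda>x. (X x)\<^sup>2)" "integrable M (\<lambda>x. (Y x)\<^sup>2)"
  shows "integrable M (\<lambda>x. X x * Y x)"
proof (rule Bochner_Integration.integrable_bound)
  show "integrable M (\<lambda>x. (X x)\<^sup>2 + (Y x)\<^sup>2)" using assms by simp
  have "\<bar>X x * Y x\<bar> \<le> (X x)\<^sup>2 + (Y x)\<^sup>2" for x
    using sum_squares_bound[of "X x" "Y x"] sum_squares_bound[of "X x" "- Y x"]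
      zero_le_power2[of "X x"] zero_le_power2[of "Y x"]
    unfolding abs_le_iff power2_minus by linarith
  then show "AE x in M. norm (X x * Y x) \<le> norm ((X x)\<^sup>2 + (Y x)\<^sup>2)" by simp
qed simp

lemma correlated_noise_moments:
  assumes "prob_space M" and noise: "correlated_noise M N P0 \<tau> \<delta>P"
    and "i \<in> N" "j \<in> N" "s \<ge> 0" "t \<ge> 0"
  shows "(\<lambda>x. \<delta>P s x $ i) \<in> borel_measurable M"
    and "integrable M (\<lambda>x. \<delta>P s x $ i * \<delta>P t x $ j)"
    and "(\<integral>x. \<delta>P s x $ i * \<delta>P t x $ j \<partial>M) =
      (if i = j then (P0 $ i)\<^sup>2 * exp (- \<bar>s - t\<bar> / \<tau>) else 0)"
proof -
  have gauss: "gaussian_rv M (\<lambda>x. \<delta>P r x $ k)" if "k \<in> N" "r \<ge> 0" for k r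
  proof -
    have "gaussian_process M (N \<times> {0..}) (\<lambda>(i, t) x. \<delta>P t x $ i)"
      using noise by (simp add: correlated_noise_def)
    \<comment> \<open>A one-term linear combination with coefficient 1 extracts the marginal
      distribution.\<close>
    then have "gaussian_rv M (\<lambda>x. \<Sum>q\<in>{(k, r)}. 1 * (case q of (i, t) \<Rightarrow> \<lambda>x. \<delta>P t x $ i) x)"
      unfolding gaussian_process_def using that by (elim allE[where x = "{(k, r)}"] allE[where x = "\<lambda>_. 1"]) auto
    then show ?thesis by simp
  qed
  note g = gauss[OF \<open>i \<in> N\<close> \<open>s \<ge> 0\<close>] gauss[OF \<open>j \<in> N\<close> \<open>t \<ge> 0\<close>]
  show "(\<lambda>x. \<delta>P s x $ i) \<in> borel_measurable M"
    using g by (simp add: gaussian_rv_def)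
  show "integrable M (\<lambda>x. \<delta>P s x $ i * \<delta>P t x $ j)"
    using g by (intro integrable_mult_square gaussian_rv_square_integrable[OF assms(1)])
      (simp_all add: gaussian_rv_def)
  show "(\<integral>x. \<delta>P s x $ i * \<delta>P t x $ j \<partial>M) =
      (if i = j then (P0 $ i)\<^sup>2 * exp (- \<bar>s - t\<bar> / \<tau>) else 0)"
    using noise assms by (simp add: correlated_noise_def)
qed

context network
begin

section \<open>Network noise in the mass-weighted coordinates\<close>

lemma damped_stiffness:
  assumes "\<mu> > 0" "\<And>u. \<mu> * (u \<bullet> u) \<le> u \<bullet> stiffness u"
  shows "damped_system stiffness \<gamma> \<mu>"
  using assms by (intro damped_system.intro linear_stiffness stiffness_sym \<gamma>_pos)

definition forcing :: "'n set \<Rightarrow> real ^ 'n \<Rightarrow> real ^ 'n"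
  where "forcing N P = (\<Sum>i\<in>N. P $ i *\<^sub>R node i)"

text \<open>The equal-time covariance operator of the forcing: one rank-one operator per noisy node,
  because different nodes are uncorrelated.\<close>

definition covariance :: "'n set \<Rightarrow> real ^ 'n \<Rightarrow> real ^ 'n \<Rightarrow> real ^ 'n"
  where "covariance N P0 a = (\<Sum>i\<in>N. ((P0 $ i)\<^sup>2 * (node i \<bullet> a)) *\<^sub>R node i)"

text \<open>The trace of a rank-one operator built from \<open>node i\<close> is the squared norm of
  \<open>node i\<close>.\<close>

lemma trace_covariance:
  "(\<Sum>a\<in>Basis. covariance N P0 a \<bullet> a) = (\<Sum>i\<in>N. (P0 $ i)\<^sup>2 * (1 / m $ i - 1 / total))"
proof -
  have "(\<Sum>a\<in>Basis. covariance N P0 a \<bullet> a)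
    = (\<Sum>a\<in>Basis. \<Sum>i\<in>N. (P0 $ i)\<^sup>2 * ((node i \<bullet> a) * (node i \<bullet> a)))"
    by (simp add: covariance_def inner_sum_left mult.assoc)
  also have "\<dots> = (\<Sum>i\<in>N. \<Sum>a\<in>Basis. (P0 $ i)\<^sup>2 * ((node i \<bullet> a) * (node i \<bullet> a)))"
    by (rule sum.swap)
  also have "\<dots> = (\<Sum>i\<in>N. (P0 $ i)\<^sup>2 * (node i \<bullet> node i))"
    by (simp add: euclidean_inner[of "node _" "node _"] sum_distrib_left)
  finally show ?thesis by (simp add: node_inner_node)
qed

lemma forcing_moments:
  assumes "prob_space M" and noise: "correlated_noise M N P0 \<tau> \<delta>P" and s: "s \<ge> 0" and t: "t \<ge> 0"
  shows "integrable M (\<lambda>x. (norm (forcing N (\<delta>P t x)))\<^sup>2)"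
    and "(\<integral>x. (forcing N (\<delta>P s x) \<bullet> a) *\<^sub>R forcing N (\<delta>P t x) \<partial>M)
      = exp (- \<bar>s - t\<bar> / \<tau>) *\<^sub>R covariance N P0 a"
proof -
  note cn = correlated_noise_moments[OF assms(1,2)]
  have "(norm (forcing N (\<delta>P t x)))\<^sup>2
      = (\<Sum>i\<in>N. \<Sum>j\<in>N. (\<delta>P t x $ i * \<delta>P t x $ j) * (node i \<bullet> node j))" for x
    unfolding power2_norm_eq_inner forcing_def inner_sum_left
    by (simp add: inner_sum_right mult_ac sum_distrib_left)
  then show "integrable M (\<lambda>x. (norm (forcing N (\<delta>P t x)))\<^sup>2)"
    using cn(2)[OF _ _ t t] by simp
  have "(forcing N (\<delta>P s x) \<bullet> a) *\<^sub>R forcing N (\<delta>P t x)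
      = (\<Sum>i\<in>N. \<Sum>j\<in>N. (\<delta>P s x $ i * \<delta>P t x $ j) *\<^sub>R ((node i \<bullet> a) *\<^sub>R node j))" for x
    unfolding forcing_def inner_sum_left scaleR_sum_left
    by (simp add: scaleR_sum_right mult_ac)
  then have "(\<integral>x. (forcing N (\<delta>P s x) \<bullet> a) *\<^sub>R forcing N (\<delta>P t x) \<partial>M)
      = (\<Sum>i\<in>N. \<Sum>j\<in>N. (\<integral>x. \<delta>P s x $ i * \<delta>P t x $ j \<partial>M) *\<^sub>R ((node i \<bullet> a) *\<^sub>R node j))"
    using cn(2)[OF _ _ s t] by (simp add: Bochner_Integration.integral_sum del: scaleR_scaleR)
  also have "\<dots> = (\<Sum>i\<in>N. ((P0 $ i)\<^sup>2 * exp (- \<bar>s - t\<bar> / \<tau>)) *\<^sub>R ((node i \<bullet> a) *\<^sub>R node i))"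
  proof (intro sum.cong refl)
    fix i assume i: "i \<in> N"
    have "(\<Sum>j\<in>N. (\<integral>x. \<delta>P s x $ i * \<delta>P t x $ j \<partial>M) *\<^sub>R ((node i \<bullet> a) *\<^sub>R node j))
      = (\<Sum>j\<in>N. if i = j then ((P0 $ i)\<^sup>2 * exp (- \<bar>s - t\<bar> / \<tau>)) *\<^sub>R ((node i \<bullet> a) *\<^sub>R node i) else 0)"
      by (intro sum.cong refl) (simp only: cn(3)[OF i _ s t] scaleR_zero_left split: if_split, simp)
    then show "(\<Sum>j\<in>N. (\<integral>x. \<delta>P s x $ i * \<delta>P t x $ j \<partial>M) *\<^sub>R ((node i \<bullet> a) *\<^sub>R node j))
      = ((P0 $ i)\<^sup>2 * exp (- \<bar>s - t\<bar> / \<tau>)) *\<^sub>R ((node i \<bullet> a) *\<^sub>R node i)"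
      using i by simp
  qed
  also have "\<dots> = exp (- \<bar>s - t\<bar> / \<tau>) *\<^sub>R covariance N P0 a"
    by (simp add: covariance_def scaleR_sum_right mult_ac)
  finally show "(\<integral>x. (forcing N (\<delta>P s x) \<bullet> a) *\<^sub>R forcing N (\<delta>P t x) \<partial>M)
      = exp (- \<bar>s - t\<bar> / \<tau>) *\<^sub>R covariance N P0 a" .
qed

lemma bounded_linear_scaled: "bounded_linear scaled"
  using linear_scaled linear_conv_bounded_linear by blast

lemma scaled_has_vector_derivative:
  "(u has_vector_derivative u') F \<Longrightarrow> ((\<lambda>t. scaled (u t)) has_vector_derivative scaled u') F"
  by (rule bounded_linear.has_vector_derivative[OF bounded_linear_scaled])

lemma measurable_scaled [measurable]: "scaled \<in> borel_measurable borel"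
  using bounded_linear_scaled by (intro borel_measurable_continuous_onI linear_continuous_on)

lemma measurable_stiffness [measurable]: "stiffness \<in> borel_measurable borel"
  using linear_stiffness
  by (intro borel_measurable_continuous_onI linear_continuous_on) (simp add: linear_conv_bounded_linear)

text \<open>
  The noise is not assumed jointly measurable, so the forcing is recovered from the response, with
  the acceleration as a limit of difference quotients of the velocity.
\<close>

lemma noise_driven_response:
  assumes M: "prob_space M" and \<tau>: "\<tau> > 0" and d: "\<And>i. d $ i = \<gamma> * m $ i"
    and \<mu>: "\<mu> > 0" "\<And>u. \<mu> * (u \<bullet> u) \<le> u \<bullet> stiffness u"
    and noise: "correlated_noise M N P0 \<tau> \<delta>P"
    and response: "linear_response M L m d \<delta>P \<delta>\<theta> \<omega>"
  obtains y z f where "noise_driven_system stiffness \<gamma> \<mu> M y z f (covariance N P0) \<tau>"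
    and "\<And>T. mean_control_effort M d \<omega> T = (1 / T) * (\<integral>x. (LBINT t:{0..T}. \<gamma> * (z t x \<bullet> z t x)) \<partial>M)"
proof -
  interpret prob_space M by fact
  define good where "good x \<longleftrightarrow> (\<forall>i. i \<notin> N \<longrightarrow> (\<forall>t\<ge>0. \<delta>P t x $ i = 0)) \<and>
      \<delta>\<theta> 0 x = 0 \<and> \<omega> 0 x = 0 \<and>
      (\<forall>t\<ge>0. ((\<lambda>s. \<delta>\<theta> s x) has_vector_derivative \<omega> t x) (at t within {0..}) \<and>
        (\<exists>\<omega>'. ((\<lambda>s. \<omega> s x) has_vector_derivative \<omega>') (at t within {0..}) \<and>
          diag_matrix m *v \<omega>' + diag_matrix d *v \<omega> t x = \<delta>P t x - L *v \<delta>\<theta> t x))" for x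
  have "AE x in M. good x"
    using noise response unfolding correlated_noise_def linear_response_def good_def
    by (auto elim: eventually_elim2)
  \<comment> \<open>The set of good paths need not be measurable, so its complement is covered by a
    measurable null set.\<close>
  then obtain Z where Z: "{x \<in> space M. \<not> good x} \<subseteq> Z" "emeasure M Z = 0" "Z \<in> sets M"
    by (rule AE_E)
  define \<Omega> where "\<Omega> = space M - Z"
  have \<Omega> [measurable]: "\<Omega> \<in> sets M" using Z by (simp add: \<Omega>_def)
  have \<Omega>_good: "good x" if "x \<in> \<Omega>" for x
    using that Z(1) by (auto simp: \<Omega>_def)
  have AE_\<Omega>: "AE x in M. x \<in> \<Omega>"
    by (rule AE_I[of _ _ Z]) (use Z in \<open>auto simp: \<Omega>_def\<close>)
  \<comment> \<open>Off \<open>\<Omega>\<close> everything is set to zero, which solves the system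
    with zero forcing, so the equations hold for every \<open>x\<close>. At negative times the value
    at time 0 is kept.\<close>
  define y where "y t x = indicat_real \<Omega> x *\<^sub>R scaled (\<delta>\<theta> (max 0 t) x)" for t x
  define z where "z t x = indicat_real \<Omega> x *\<^sub>R scaled (\<omega> (max 0 t) x)" for t x
  define z' where "z' t x = lim (\<lambda>n. real (Suc n) *\<^sub>R (z (t + 1 / real (Suc n)) x - z t x))" for t x
  define f where "f t x = z' t x + \<gamma> *\<^sub>R z t x + stiffness (y t x)" for t x
  have "measurable_process M \<delta>\<theta>" "measurable_process M \<omega>"
    using response by (simp_all add: linear_response_def)
  note [measurable] = this[THEN measurable_process_clamped]
  have meas_y [measurable]: "(\<lambda>(t, x). y t x) \<in> borel_measurable (borel \<Otimes>\<^sub>M M)"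
    unfolding y_def by measurable
  have meas_z [measurable]: "(\<lambda>(t, x). z t x) \<in> borel_measurable (borel \<Otimes>\<^sub>M M)"
    unfolding z_def by measurable
  have meas_f [measurable]: "(\<lambda>(t, x). f t x) \<in> borel_measurable (borel \<Otimes>\<^sub>M M)"
    unfolding f_def z'_def by measurable
  have y_deriv: "((\<lambda>s. y s x) has_vector_derivative z t x) (at t within {0..})"
    if "t \<ge> 0" for t x
  proof (cases "x \<in> \<Omega>")
    case True
    have "((\<lambda>s. scaled (\<delta>\<theta> s x)) has_vector_derivative scaled (\<omega> t x)) (at t within {0..})"
      using \<Omega>_good[OF True] that by (intro scaled_has_vector_derivative) (simp add: good_def)
    then have "((\<lambda>s. y s x) has_vector_derivative scaled (\<omega> t x)) (at t within {0..})"
      by (rule has_vector_derivative_transform[rotated 2]) (use that True in \<open>auto simp: y_def\<close>)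
    then show ?thesis using that True by (simp add: z_def)
  qed (simp add: y_def z_def)
  have z_deriv: "((\<lambda>s. z s x) has_vector_derivative z' t x) (at t within {0..}) \<and>
      (x \<in> \<Omega> \<longrightarrow> f t x = forcing N (\<delta>P t x))"
    if t: "t \<ge> 0" for t x
  proof (cases "x \<in> \<Omega>")
    case True
    obtain \<omega>' where \<omega>': "((\<lambda>s. \<omega> s x) has_vector_derivative \<omega>') (at t within {0..})"
      and ode: "diag_matrix m *v \<omega>' + diag_matrix d *v \<omega> t x = \<delta>P t x - L *v \<delta>\<theta> t x"
      using \<Omega>_good[OF True] t by (auto simp: good_def)
    have zd: "((\<lambda>s. z s x) has_vector_derivative scaled \<omega>') (at t within {0..})"
      using scaled_has_vector_derivative[OF \<omega>']
      by (rule has_vector_derivative_transform[rotated 2]) (use t True in \<open>auto simp: z_def\<close>)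
    have z': "z' t x = scaled \<omega>'"
      unfolding z'_def using difference_quotients_tendsto[OF zd t] by (rule limI)
    have "m $ i * \<omega>' $ i + \<gamma> * m $ i * \<omega> t x $ i = \<delta>P t x $ i - (L *v \<delta>\<theta> t x) $ i" for i
      using arg_cong[OF ode, of "\<lambda>u. u $ i"] by (simp add: diag_matrix_vector d)
    then have "\<omega>' + \<gamma> *\<^sub>R \<omega> t x + (\<chi> i. (L *v \<delta>\<theta> t x) $ i / m $ i) = (\<chi> i. \<delta>P t x $ i / m $ i)"
      by (simp add: vec_eq_iff field_simps)
    then have "scaled (\<chi> i. \<delta>P t x $ i / m $ i)
        = scaled (\<omega>' + \<gamma> *\<^sub>R \<omega> t x + (\<chi> i. (L *v \<delta>\<theta> t x) $ i / m $ i))"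
      by (simp only:)
    also have "\<dots> = scaled \<omega>' + \<gamma> *\<^sub>R scaled (\<omega> t x) + stiffness (scaled (\<delta>\<theta> t x))"
      by (simp add: stiffness_scaled linear_add[OF linear_scaled] linear_scale[OF linear_scaled])
    finally have "scaled (\<chi> i. \<delta>P t x $ i / m $ i)
        = scaled \<omega>' + \<gamma> *\<^sub>R scaled (\<omega> t x) + stiffness (scaled (\<delta>\<theta> t x))" .
    then have "f t x = (\<Sum>i\<in>UNIV. \<delta>P t x $ i *\<^sub>R node i)"
      using True t unfolding scaled_sum_node by (simp add: f_def z' y_def z_def)
    also have "\<dots> = forcing N (\<delta>P t x)"
      unfolding forcing_def using \<Omega>_good[OF True] t
      by (intro sum.mono_neutral_right) (auto simp: good_def)
    finally show ?thesis using zd z' by simp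
  next
    case False
    then have "z' t x = 0" by (simp add: z'_def z_def)
    with False show ?thesis by (simp add: z_def)
  qed
  have f_AE: "AE x in M. f t x = forcing N (\<delta>P t x)" if "t \<ge> 0" for t
    using AE_\<Omega> z_deriv[OF that] by auto
  have f_meas: "f t \<in> borel_measurable M" for t
    using borel_measurable_section[OF meas_f, of t] by simp
  have forcing_meas: "(\<lambda>x. forcing N (\<delta>P t x)) \<in> borel_measurable M" if "t \<ge> 0" for t
    unfolding forcing_def
    using correlated_noise_moments(1)[OF M noise _ _ that that]
    by (intro borel_measurable_sum borel_measurable_scaleR) auto
  have system: "noise_driven_system stiffness \<gamma> \<mu> M y z f (covariance N P0) \<tau>"
  proof (intro noise_driven_system.intro noise_driven_system_axioms.intro)
    show "damped_system stiffness \<gamma> \<mu>" using \<mu> by (rule damped_stiffness)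
    show "prob_space M" "\<tau> > 0" by fact+
    show "((\<lambda>s. y s x) has_vector_derivative z t x) (at t within {0..})" if "t \<ge> 0" for t x
      using that by (rule y_deriv)
    show "((\<lambda>s. z s x) has_vector_derivative f t x - \<gamma> *\<^sub>R z t x - stiffness (y t x)) (at t within {0..})"
      if "t \<ge> 0" for t x
      using z_deriv[OF that, of x] by (simp add: f_def)
    show "y 0 x = 0" "z 0 x = 0" for x
      using \<Omega>_good[of x] linear_0[OF linear_scaled] by (auto simp: y_def z_def good_def indicator_def)
    show "integrable M (\<lambda>x. (norm (f t x))\<^sup>2)" if t: "t \<ge> 0" for t
    proof (subst integrable_cong_AE)
      show "AE x in M. (norm (f t x))\<^sup>2 = (norm (forcing N (\<delta>P t x)))\<^sup>2"
        using f_AE[OF t] by eventually_elim simp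
      show "integrable M (\<lambda>x. (norm (forcing N (\<delta>P t x)))\<^sup>2)"
        by (rule forcing_moments(1)[OF M noise t t])
    qed (use f_meas forcing_meas[OF t] in measurable)
    show "(\<integral>x. (f s x \<bullet> a) *\<^sub>R f t x \<partial>M) = exp (- \<bar>s - t\<bar> / \<tau>) *\<^sub>R covariance N P0 a"
      if s: "s \<ge> 0" and t: "t \<ge> 0" for s t a
    proof -
      have "(\<integral>x. (f s x \<bullet> a) *\<^sub>R f t x \<partial>M)
        = (\<integral>x. (forcing N (\<delta>P s x) \<bullet> a) *\<^sub>R forcing N (\<delta>P t x) \<partial>M)"
      proof (rule integral_cong_AE)
        show "AE x in M. (f s x \<bullet> a) *\<^sub>R f t x = (forcing N (\<delta>P s x) \<bullet> a) *\<^sub>R forcing N (\<delta>P t x)"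
          using f_AE[OF s] f_AE[OF t] by eventually_elim simp
      qed (use f_meas[of s] f_meas[of t] forcing_meas[OF t] forcing_meas[OF s] in measurable)
      then show ?thesis using forcing_moments(2)[OF M noise s t] by simp
    qed
  qed measurable
  have effort: "mean_control_effort M d \<omega> T = (1 / T) * (\<integral>x. (LBINT t:{0..T}. \<gamma> * (z t x \<bullet> z t x)) \<partial>M)" for T
  proof -
    \<comment> \<open>\<open>?J\<close> belongs to the original response, clamped only at times
      outside the range of integration; \<open>z\<close> differs from it on a null set of
      paths.\<close>
    let ?J = "\<lambda>x. LBINT t:{0..T}. \<gamma> * (scaled (\<omega> (max 0 t) x) \<bullet> scaled (\<omega> (max 0 t) x))"
    have J_meas: "?J \<in> borel_measurable M"
      unfolding set_lebesgue_integral_def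
      by (rule lborel.borel_measurable_lebesgue_integral) measurable
    have z_meas: "(\<lambda>x. LBINT t:{0..T}. \<gamma> * (z t x \<bullet> z t x)) \<in> borel_measurable M"
      unfolding set_lebesgue_integral_def
      by (rule lborel.borel_measurable_lebesgue_integral) measurable
    have "primary_control_effort d (\<lambda>t. \<omega> t x) T = (1 / T) * ?J x" for x
      unfolding primary_control_effort_def control_effort_scaled[of d, OF d] set_lebesgue_integral_def
      by (intro arg_cong2[where f = "(*)"] refl Bochner_Integration.integral_cong) (auto simp: indicator_def)
    then have "mean_control_effort M d \<omega> T = (1 / T) * (\<integral>x. ?J x \<partial>M)"
      by (simp add: mean_control_effort_def)
    also have "(\<integral>x. ?J x \<partial>M) = (\<integral>x. (LBINT t:{0..T}. \<gamma> * (z t x \<bullet> z t x)) \<partial>M)"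
      by (rule integral_cong_AE[OF J_meas z_meas]) (use AE_\<Omega> in \<open>eventually_elim, simp add: z_def\<close>)
    finally show ?thesis .
  qed
  show ?thesis by (rule that[OF system effort])
qed

end

section \<open>The limit of short correlation time\<close>

lemma weighted_laplacian_ones: "weighted_laplacian b \<theta>0 *v (\<chi> i. 1) = 0"
proof -
  have "(\<Sum>j\<in>UNIV. weighted_laplacian b \<theta>0 $ i $ j) = 0" for i
  proof -
    have "(\<Sum>j\<in>UNIV. weighted_laplacian b \<theta>0 $ i $ j)
      = weighted_laplacian b \<theta>0 $ i $ i + (\<Sum>j\<in>UNIV - {i}. weighted_laplacian b \<theta>0 $ i $ j)"
      by (rule sum.remove) auto
    also have "(\<Sum>j\<in>UNIV - {i}. weighted_laplacian b \<theta>0 $ i $ j)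
      = - (\<Sum>j\<in>UNIV - {i}. b $ i $ j * cos (\<theta>0 $ i - \<theta>0 $ j))"
      unfolding sum_negf[symmetric] by (intro sum.cong refl) (auto simp: weighted_laplacian_def)
    finally show ?thesis by (simp add: weighted_laplacian_def)
  qed
  then show ?thesis by (simp add: vec_eq_iff matrix_vector_mult_def)
qed

text \<open>Each correlation time has its own probability space, noise and response, since only the
  limits, as numbers, are compared. The proof gives a remainder of order
  \<open>\<tau>\<^sup>2\<close>.\<close>

theorem corollary1:
  fixes b :: "real ^ 'n ^ 'n"
    and m d p \<theta>0 P0 :: "real ^ 'n"
    and \<gamma> :: real
    and N :: "'n set"
    and M :: "real \<Rightarrow> 'a measure"
    and \<delta>P \<delta>\<theta> \<omega> :: "real \<Rightarrow> real \<Rightarrow> 'a \<Rightarrow> real ^ 'n"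
  assumes "\<And>i j. b $ i $ j = b $ j $ i"
    and "\<And>i j. b $ i $ j \<ge> 0"
    and "\<And>i. m $ i > 0"
    and "\<And>i. d $ i > 0"
    and "\<gamma> > 0"
    and "\<And>i. d $ i / m $ i = \<gamma>"
    and "synchronous_state b m d p \<theta>0"
    and "positive_semidefinite (weighted_laplacian b \<theta>0)"
    and "simple_eigenvalue (weighted_laplacian b \<theta>0) 0"
    and "\<And>\<tau>. \<tau> > 0 \<Longrightarrow> prob_space (M \<tau>)"
    and "\<And>\<tau>. \<tau> > 0 \<Longrightarrow> correlated_noise (M \<tau>) N P0 \<tau> (\<delta>P \<tau>)"
    and "\<And>\<tau>. \<tau> > 0 \<Longrightarrow>
           linear_response (M \<tau>) (weighted_laplacian b \<theta>0) m d (\<delta>P \<tau>) (\<delta>\<theta> \<tau>) (\<omega> \<tau>)"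
  shows "\<exists>Pinf :: real \<Rightarrow> real.
           (\<forall>\<tau>>0. (mean_control_effort (M \<tau>) d (\<omega> \<tau>) \<longlongrightarrow> Pinf \<tau>) at_top) \<and>
           (\<lambda>\<tau>. Pinf \<tau> - \<tau> * (\<Sum>i\<in>N. (P0 $ i)\<^sup>2 * (1 / m $ i - 1 / (\<Sum>j\<in>UNIV. m $ j))))
             \<in> o[at_right 0](\<lambda>\<tau>. \<tau>)"
proof -
  interpret network "weighted_laplacian b \<theta>0" m \<gamma>
    using assms by unfold_locales (simp_all add: weighted_laplacian_ones)
  let ?R = "covariance N P0"
  have d: "d $ i = \<gamma> * m $ i" for i
    using assms(6)[of i] assms(3)[of i] by (simp add: field_simps)
  obtain \<mu> where \<mu>: "\<mu> > 0" "\<And>u. \<mu> * (u \<bullet> u) \<le> u \<bullet> stiffness u"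
    using stiffness_coercive by blast
  interpret S: damped_system stiffness \<gamma> \<mu>
    using \<mu> by (rule damped_stiffness)
  \<comment> \<open>The amplitudes are chosen as functions of \<open>\<tau>\<close> and
    \<open>a\<close> alone, so \<open>Pinf\<close> does not depend on how the noise is
    realized.\<close>
  have "\<forall>\<tau> a. \<exists>C. \<tau> > 0 \<longrightarrow> (1 / \<tau>\<^sup>2 + \<gamma> / \<tau>) *\<^sub>R C + stiffness C = ?R a"
    using S.resolvent_exists \<gamma>_pos by (metis add_pos_pos divide_pos_pos zero_less_one zero_less_power)
  then obtain C where C: "\<And>\<tau> a. \<tau> > 0 \<Longrightarrow> (1 / \<tau>\<^sup>2 + \<gamma> / \<tau>) *\<^sub>R C \<tau> a + stiffness (C \<tau> a) = ?R a"
    by metis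
  define Pinf where "Pinf \<tau> = (\<Sum>a\<in>Basis. C \<tau> a \<bullet> a) / \<tau>" for \<tau>
  have limit: "(mean_control_effort (M \<tau>) d (\<omega> \<tau>) \<longlongrightarrow> Pinf \<tau>) at_top" if \<tau>: "\<tau> > 0" for \<tau>
  proof -
    obtain y z f where sys: "noise_driven_system stiffness \<gamma> \<mu> (M \<tau>) y z f ?R \<tau>"
      and eff: "\<And>T. mean_control_effort (M \<tau>) d (\<omega> \<tau>) T
        = (1 / T) * (\<integral>x. (LBINT t:{0..T}. \<gamma> * (z t x \<bullet> z t x)) \<partial>M \<tau>)"
      using noise_driven_response[OF assms(10)[OF \<tau>] \<tau> d \<mu> assms(11)[OF \<tau>] assms(12)[OF \<tau>]] by blast
    interpret noise_driven_system stiffness \<gamma> \<mu> "M \<tau>" y z f ?R \<tau> by (fact sys)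
    show ?thesis
      unfolding Pinf_def eff using C[OF \<tau>] by (rule mean_dissipation_tendsto)
  qed
  let ?lead = "\<Sum>i\<in>N. (P0 $ i)\<^sup>2 * (1 / m $ i - 1 / (\<Sum>j\<in>UNIV. m $ j))"
  have lead: "?lead = (\<Sum>a\<in>Basis. ?R a \<bullet> a)"
    unfolding trace_covariance total_def ..
  \<comment> \<open>For each basis vector the constant is chosen before \<open>\<tau>\<close>; the
    finite sum of these constants is therefore uniform in \<open>\<tau>\<close>.\<close>
  have "\<exists>K. \<forall>\<tau> C. \<tau> > 0 \<longrightarrow> \<tau> \<le> 1 \<longrightarrow> (1 / \<tau>\<^sup>2 + \<gamma> / \<tau>) *\<^sub>R C + stiffness C = ?R a \<longrightarrow>
      norm ((1 / \<tau>) *\<^sub>R C - \<tau> *\<^sub>R ?R a) \<le> K * \<tau>\<^sup>2" for a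
    by (rule S.resolvent_asymptotics[of "?R a"]) blast
  then obtain K where K: "\<And>a \<tau> C. \<lbrakk>\<tau> > 0; \<tau> \<le> 1; (1 / \<tau>\<^sup>2 + \<gamma> / \<tau>) *\<^sub>R C + stiffness C = ?R a\<rbrakk> \<Longrightarrow>
      norm ((1 / \<tau>) *\<^sub>R C - \<tau> *\<^sub>R ?R a) \<le> K a * \<tau>\<^sup>2"
    by metis
  have bound: "norm (Pinf \<tau> - \<tau> * ?lead) \<le> (\<Sum>a\<in>Basis. K a) * norm (\<tau>\<^sup>2)" if \<tau>: "\<tau> > 0" "\<tau> \<le> 1" for \<tau>
  proof -
    have "Pinf \<tau> - \<tau> * ?lead = (\<Sum>a\<in>Basis. ((1 / \<tau>) *\<^sub>R C \<tau> a - \<tau> *\<^sub>R ?R a) \<bullet> a)"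
      unfolding lead Pinf_def
      by (simp add: inner_diff_left sum_subtractf sum_distrib_left sum_divide_distrib)
    also have "norm \<dots> \<le> (\<Sum>a\<in>Basis. K a * \<tau>\<^sup>2)"
    proof (rule order_trans[OF norm_sum], rule sum_mono)
      fix a :: "real ^ 'n" assume a: "a \<in> Basis"
      show "norm (((1 / \<tau>) *\<^sub>R C \<tau> a - \<tau> *\<^sub>R ?R a) \<bullet> a) \<le> K a * \<tau>\<^sup>2"
        unfolding real_norm_def
        by (rule order_trans[OF Basis_le_norm[OF a] K[OF \<tau> C[OF \<tau>(1)]]])
    qed
    finally show ?thesis by (simp add: sum_distrib_right)
  qed
  have "(\<lambda>\<tau>. Pinf \<tau> - \<tau> * ?lead) \<in> O[at_right 0](\<lambda>\<tau>. \<tau>\<^sup>2)"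
  proof (rule bigoI)
    show "eventually (\<lambda>\<tau>. norm (Pinf \<tau> - \<tau> * ?lead) \<le> (\<Sum>a\<in>Basis. K a) * norm (\<tau>\<^sup>2)) (at_right 0)"
      unfolding eventually_at_right_field by (rule exI[of _ 1]) (use bound in auto)
  qed
  also have "(\<lambda>\<tau>::real. \<tau>\<^sup>2) \<in> o[at_right 0](\<lambda>\<tau>. \<tau>)"
  proof (rule smalloI_tendsto)
    have "((\<lambda>\<tau>::real. \<tau>) \<longlongrightarrow> 0) (at_right 0)" by (rule tendsto_ident_at)
    then show "((\<lambda>\<tau>::real. \<tau>\<^sup>2 / \<tau>) \<longlongrightarrow> 0) (at_right 0)"
      by (simp add: power2_eq_square)
    show "eventually (\<lambda>\<tau>::real. \<tau> \<noteq> 0) (at_right 0)"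
      using eventually_at_right_less[of "0::real"] by eventually_elim simp
  qed
  finally have "(\<lambda>\<tau>. Pinf \<tau> - \<tau> * ?lead) \<in> o[at_right 0](\<lambda>\<tau>. \<tau>)" .
  with limit show ?thesis by blast
qed

end
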